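(* Let $\nu : \mathbb{R} \to \mathbb{R}_{>0}$ be a positive, real-valued function satisfying the following conditions: (1) $\lim_{x \to \infty} \nu(x) = 0$; (2) for $x > 1$, the function $f(x) := (\log x)^{\nu(x)}$ is increasing, and $\lim_{x \to \infty} f(x) = \infty$. Let $\varepsilon>0$. Then there exists an effectively computable constant $Q_0 = Q_0(\nu,\varepsilon) \geq 1$, depending at most on $\nu$ and $\varepsilon$, with the following property. For any $Q \geq Q_0$ such that $L(s,\chi)$ satisfies Hypothesis $H_f$ for all $\chi \in \mathcal{S}(Q^2)$, we have $$\#\{\chi\in \mathcal{S}(Q) : L(s,\chi) \text{ has a real zero in } [1-(\log Q)^{-\varepsilon},1)\}\leq 1.$$
   Context: For a primitive Dirichlet character $\chi$, $q_\chi$ denotes its conductor (modulus) and $L(s,\chi)$ its Dirichlet $L$-function (analytically continued). For $Q \geq 2$, $$\mathcal{S}(Q)=\{\chi \bmod q_{\chi} : \chi \text{ primitive and real},\ 1 \leq q_{\chi} \leq Q\}.$$ Hypothesis $H_f$: let $f(x)$ be a positive real-valued increasing function with $\lim_{x\to\infty} f(x)=\infty$. For a primitive real character $\chi \bmod q_\chi$, we say that $L(s,\chi)$ satisfies Hypothesis $H_f$ provided all the zeros of $L(s,\chi)$ inside the disk $|s-1|<1/f(q_\chi)$, if any, are real. Since $f$ is only defined for $x>1$, Hypothesis $H_f$ is understood as a condition on the characters with $q_\chi>1$; nothing is assumed for the trivial character ($q_\chi=1$, $L(s,\chi)=\zeta(s)$). *)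

theory Defs
  imports "HOL-Complex_Analysis.Complex_Analysis"
begin

section \<open>Dirichlet characters and their L-functions\<close>

definition dirichlet_char :: "nat \<Rightarrow> (nat \<Rightarrow> complex) \<Rightarrow> bool" where
  "dirichlet_char q chi \<longleftrightarrow>
     q > 0 \<and>
     (\<forall>m n. chi (m * n) = chi m * chi n) \<and>
     (\<forall>n. chi (n + q) = chi n) \<and>
     (\<forall>n. chi n \<noteq> 0 \<longleftrightarrow> coprime n q)"

definition principal_char :: "nat \<Rightarrow> (nat \<Rightarrow> complex) \<Rightarrow> bool" where
  "principal_char q chi \<longleftrightarrow> dirichlet_char q chi \<and> (\<forall>n. coprime n q \<longrightarrow> chi n = 1)"

definition induced_by :: "nat \<Rightarrow> (nat \<Rightarrow> complex) \<Rightarrow> nat \<Rightarrow> (nat \<Rightarrow> complex) \<Rightarrow> bool" where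
  "induced_by q chi d \<psi> \<longleftrightarrow>
     dirichlet_char d \<psi> \<and> d dvd q \<and> (\<forall>n. coprime n q \<longrightarrow> chi n = \<psi> n)"

definition primitive_char :: "nat \<Rightarrow> (nat \<Rightarrow> complex) \<Rightarrow> bool" where
  "primitive_char q chi \<longleftrightarrow> dirichlet_char q chi \<and> (\<forall>d \<psi>. induced_by q chi d \<psi> \<longrightarrow> d = q)"

text \<open>
  The set \<open>S(Q)\<close>. Its members are pairs of a modulus and a character. As the modulus of a
  primitive character is determined by the character, counting pairs is counting characters.
\<close>
definition real_primitive_chars :: "real \<Rightarrow> (nat \<times> (nat \<Rightarrow> complex)) set" where
  "real_primitive_chars Q =
     {(q, chi). primitive_char q chi \<and> (\<forall>n. chi n \<in> \<real>) \<and> 1 \<le> q \<and> real q \<le> Q}"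

text \<open>
  \<open>F\<close> continues the Dirichlet series of \<open>chi\<close> analytically to the half-plane \<open>Re s > c\<close>,
  apart from the pole at 1 when \<open>chi\<close> is principal.
\<close>
definition continues_L :: "nat \<Rightarrow> (nat \<Rightarrow> complex) \<Rightarrow> real \<Rightarrow> (complex \<Rightarrow> complex) \<Rightarrow> bool" where
  "continues_L q chi c F \<longleftrightarrow>
     F holomorphic_on ({s. c < Re s} - (if principal_char q chi then {1} else {})) \<and>
     (\<forall>s. 1 < Re s \<longrightarrow> (\<lambda>n. chi (Suc n) / of_nat (Suc n) powr s) sums F s)"

text \<open>
  The half-planes are nested, and they stay connected when the point 1 is removed, so the value
  at \<open>s\<close> does not depend on the choice of \<open>c\<close> and \<open>F\<close>. The exception is the pole itself, \<open>s = 1\<close>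
  with \<open>chi\<close> principal, where the value is unspecified.
\<close>
definition dirichlet_L :: "nat \<Rightarrow> (nat \<Rightarrow> complex) \<Rightarrow> complex \<Rightarrow> complex" where
  "dirichlet_L q chi s = (THE z. \<exists>c F. c < Re s \<and> continues_L q chi c F \<and> z = F s)"

definition hypothesis_H :: "(real \<Rightarrow> real) \<Rightarrow> nat \<Rightarrow> (nat \<Rightarrow> complex) \<Rightarrow> bool" where
  "hypothesis_H f q chi \<longleftrightarrow>
     (q > 1 \<longrightarrow> (\<forall>s. dirichlet_L q chi s = 0 \<and> norm (s - 1) < 1 / f (real q) \<longrightarrow> s \<in> \<real>))"

definition has_real_zero_in :: "nat \<Rightarrow> (nat \<Rightarrow> complex) \<Rightarrow> real set \<Rightarrow> bool" where
  "has_real_zero_in q chi I \<longleftrightarrow> (\<exists>\<beta>\<in>I. dirichlet_L q chi (of_real \<beta>) = 0)"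


section \<open>Effective computability\<close>

text \<open>
  Kleene's partial recursive functions relative to a family of oracles \<open>A 0, A 1, \<dots>\<close>.
  \<open>computes A p xs y\<close>: the program \<open>p\<close>, run on \<open>xs\<close> with the oracles \<open>A\<close>, halts with value \<open>y\<close>.
\<close>
datatype program =
    Zero
  | Succ
  | Proj nat
  | Query nat
  | Comp program "program list"
  | PrimRec program program
  | Minimize program

inductive computes :: "(nat \<Rightarrow> nat \<Rightarrow> nat) \<Rightarrow> program \<Rightarrow> nat list \<Rightarrow> nat \<Rightarrow> bool"
  for A :: "nat \<Rightarrow> nat \<Rightarrow> nat" where
  zero: "computes A Zero xs 0"
| succ: "computes A Succ [x] (Suc x)"
| proj: "i < length xs \<Longrightarrow> computes A (Proj i) xs (xs ! i)"
| query: "computes A (Query i) [x] (A i x)"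
| comp: "list_all2 (\<lambda>g y. computes A g xs y) gs ys \<Longrightarrow> computes A f ys z \<Longrightarrow>
           computes A (Comp f gs) xs z"
| primrec_0: "computes A f xs y \<Longrightarrow> computes A (PrimRec f g) (0 # xs) y"
| primrec_Suc: "computes A (PrimRec f g) (n # xs) y \<Longrightarrow> computes A g (n # y # xs) z \<Longrightarrow>
           computes A (PrimRec f g) (Suc n # xs) z"
| minimize: "computes A f (n # xs) 0 \<Longrightarrow> (\<And>m. m < n \<Longrightarrow> \<exists>y. computes A f (m # xs) (Suc y)) \<Longrightarrow>
           computes A (Minimize f) xs n"

inductive_cases computes_ZeroE: "computes A Zero xs y"
inductive_cases computes_SuccE: "computes A Succ xs y"
inductive_cases computes_ProjE: "computes A (Proj i) xs y"
inductive_cases computes_QueryE: "computes A (Query i) xs y"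
inductive_cases computes_CompE: "computes A (Comp f gs) xs y"
inductive_cases computes_PrimRec_0E: "computes A (PrimRec f g) (0 # xs) y"
inductive_cases computes_PrimRec_SucE: "computes A (PrimRec f g) (Suc n # xs) y"
inductive_cases computes_MinimizeE: "computes A (Minimize f) xs y"

lemma computes_deterministic:
  assumes "computes A p xs y" and "computes A p xs z"
  shows "y = z"
  using assms
proof (induction arbitrary: z)
  case (zero xs)
  then show ?case by (rule computes_ZeroE) simp
next
  case (succ x)
  then show ?case by (rule computes_SuccE) simp
next
  case (proj i xs)
  from proj.prems show ?case by (rule computes_ProjE) simp
next
  case (query i x)
  then show ?case by (rule computes_QueryE) simp
next
  case (comp xs gs ys f w)
  from comp.prems obtain ys' where
    ys': "list_all2 (\<lambda>g y. computes A g xs y) gs ys'" "computes A f ys' z"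
    by (rule computes_CompE) blast
  have "ys = ys'"
    using comp.IH(1) ys'(1) by (auto simp: list_all2_conv_all_nth intro!: nth_equalityI)
  with ys'(2) comp.IH(2) show ?case by blast
next
  case (primrec_0 f xs y g)
  from primrec_0.prems show ?case
    by (rule computes_PrimRec_0E) (rule primrec_0.IH)
next
  case (primrec_Suc f g n xs y w)
  from primrec_Suc.prems obtain y' where
    y': "computes A (PrimRec f g) (n # xs) y'" "computes A g (n # y' # xs) z"
    by (rule computes_PrimRec_SucE) blast
  with primrec_Suc.IH show ?case by blast
next
  case (minimize f n xs)
  from minimize.prems have
    z: "computes A f (z # xs) 0" "\<And>m. m < z \<Longrightarrow> \<exists>y. computes A f (m # xs) (Suc y)"
    by (blast elim: computes_MinimizeE)+
  have "\<not> z < n" using minimize.IH(2) z(1) by blast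
  moreover have "\<not> n < z" using minimize.IH(1) z(2) by blast
  ultimately show ?case by simp
qed

text \<open>
  The data through which a constant can depend effectively on an arbitrary
  real function \<open>\<nu>\<close> and a real number \<open>\<epsilon> > 0\<close>: a rate of convergence \<open>A 0\<close> for \<open>\<nu>(x) \<rightarrow> 0\<close>,
  a rate of divergence \<open>A 1\<close> for \<open>ln x powr \<nu> x \<rightarrow> \<infinity>\<close>, and a positive rational lower bound \<open>1/k\<close>
  for \<open>\<epsilon>\<close>.
\<close>
definition effective_data ::
  "(real \<Rightarrow> real) \<Rightarrow> real \<Rightarrow> (nat \<Rightarrow> nat \<Rightarrow> nat) \<Rightarrow> nat \<Rightarrow> bool" where
  "effective_data \<nu> \<epsilon> A k \<longleftrightarrow>
     (\<forall>n x. real (A 0 n) \<le> x \<longrightarrow> \<nu> x \<le> 1 / real (Suc n)) \<and>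
     (\<forall>n x. 1 < x \<and> real (A 1 n) \<le> x \<longrightarrow> real n \<le> ln x powr \<nu> x) \<and>
     0 < k \<and> 1 / real k \<le> \<epsilon>"

lemma effective_data_exists:
  assumes "(\<nu> \<longlongrightarrow> 0) at_top"
    and "filterlim (\<lambda>x. ln x powr \<nu> x) at_top at_top"
    and "0 < \<epsilon>"
  shows "\<exists>A k. effective_data \<nu> \<epsilon> A k"
proof -
  have bound: "\<exists>N::nat. \<forall>x. real N \<le> x \<longrightarrow> P x" if "eventually P at_top" for P :: "real \<Rightarrow> bool"
    using that unfolding eventually_at_top_linorder
    by (meson order.trans real_arch_simple)
  have "eventually (\<lambda>x. \<nu> x < 1 / real (Suc n)) at_top" for n
    by (rule order_tendstoD(2)[OF assms(1)]) simp
  then have "\<exists>N::nat. \<forall>x. real N \<le> x \<longrightarrow> \<nu> x < 1 / real (Suc n)" for n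
    using bound by blast
  then obtain M where M: "\<And>n x. real (M n) \<le> x \<Longrightarrow> \<nu> x < 1 / real (Suc n)"
    by metis
  have "eventually (\<lambda>x. real n \<le> ln x powr \<nu> x) at_top" for n
    using assms(2) by (auto simp: filterlim_at_top)
  then have "\<exists>N::nat. \<forall>x. real N \<le> x \<longrightarrow> real n \<le> ln x powr \<nu> x" for n
    using bound by blast
  then obtain N where N: "\<And>n x. real (N n) \<le> x \<Longrightarrow> real n \<le> ln x powr \<nu> x"
    by metis
  obtain k where k: "0 < k" "1 / real k < \<epsilon>"
    using nat_approx_posE[OF assms(3)] by (metis zero_less_Suc)
  have "effective_data \<nu> \<epsilon> (\<lambda>i. if i = 0 then M else N) k"
    using M N k unfolding effective_data_def by (auto intro: less_imp_le)
  then show ?thesis by blast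
qed

end

theory Submission
  imports Defs "HOL-Number_Theory.Prime_Powers" "HOL-Number_Theory.Cong"
begin

text \<open>
  Suppose that two different real primitive characters \<open>chi1\<close> and \<open>chi2\<close>, of conductors at most
  \<open>Q\<close>, have real zeros \<open>beta1\<close> and \<open>beta2\<close> in \<open>[1 - \<delta>, 1)\<close>. The proof plays a single pole off
  against two zeros. Put \<open>G(s) = (s - 1) \<zeta>(s) L(s,chi1) L(s,chi2) L(s,chi1 chi2)\<close> and look at
  \<open>G'/G\<close> at the real point \<open>s0 = 1 + \<eta>\<close>, not at one value but at the \<open>j\<close>-th derivative, which
  carries the signed factor \<open>(-1)^j / j!\<close>: a zero \<open>\<rho>\<close> of \<open>G\<close> then contributes
  \<open>1 / (s0 - \<rho>)^(j+1)\<close>.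

  Upper bound. The logarithm of \<open>\<zeta>(s) L(s,chi1) L(s,chi2) L(s,chi1 chi2)\<close> has the
  coefficients \<open>\<Lambda>(n) (1 + chi1(n)) (1 + chi2(n)) / log n\<close>, which are nonnegative, so the whole
  \<open>j\<close>-th derivative is at most \<open>1/\<eta>^(j+1)\<close>, the share of the one factor \<open>s - 1\<close>
  (\<open>log_deriv_coeff_biquadratic_nonpos\<close>).

  Lower bound. The zeros \<open>beta1\<close> and \<open>beta2\<close> contribute at least \<open>2 / (\<eta> + \<delta>)^(j+1)\<close>. Every
  other zero within distance \<open>r\<close> of \<open>s0\<close> is real and to the left of \<open>s0\<close>, so it contributes a
  positive amount and may be discarded. Zeros at distance at least \<open>r\<close> are harmless because a
  high derivative damps them: they contribute \<open>O((2/r)^(j+1) log (M / |G(s0)|))\<close>, where \<open>M\<close>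
  bounds \<open>G\<close> on a disk of fixed radius (\<open>log_deriv_coeff_lower_bound\<close>). Here \<open>M\<close> is
  polynomial in \<open>Q\<close>, and \<open>|G(s0)| \<ge> \<eta>/16\<close> since \<open>|G(s)/(s - 1)|\<close> decreases along the real
  axis, so the error is \<open>O((2/r)^(j+1) log Q)\<close>.

  The hypothesis makes this useful: \<open>f(Q^2)\<close> is \<open>(log Q)\<close> to a power tending to 0, so all zeros
  are real within a radius that is far larger than \<open>\<delta> = (log Q)^(-\<epsilon>)\<close>. In terms of
  \<open>y = (log Q)^(1/(4k))\<close>, where \<open>1/k \<le> \<epsilon>\<close>, the radius of reality is at least \<open>1/(2y)\<close>, while
  \<open>\<delta> \<le> y^(-4)\<close>. With \<open>r = 1/(4y)\<close>, the intermediate scale \<open>\<eta> = y^(-2)\<close> and \<open>j + 1 = 4k + 1\<close>,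
  multiplication by \<open>\<eta>^(j+1)\<close> turns the two bounds into \<open>2 - o(1) \<le> 1 + O(1/y)\<close>, which fails
  for large \<open>y\<close> (\<open>two_zeros_inequality\<close>, \<open>two_zeros_inequality_fails\<close>).

  It is enough to work with the possibly imprimitive product \<open>chi1 chi2\<close> modulo \<open>q1 q2\<close>: its
  L-function differs from that of the primitive character inducing it, which has conductor at
  most \<open>Q^2\<close>, by Euler factors without zeros in \<open>Re s > 0\<close> (\<open>induced_zero\<close>).

  The only demands on \<open>Q\<close> are \<open>\<nu>(Q^2) \<le> 1/(4k)\<close>, which the modulus of convergence guarantees
  beyond \<open>A 0 (4k)\<close>, and that \<open>y\<close> exceeds an explicit exponential function of \<open>k\<close>, which holds
  beyond \<open>2^(2^(m k^2))\<close> for an absolute constant \<open>m\<close>. The sum of the two is the threshold, a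
  program with one oracle call.
\<close>

section \<open>Primitive recursive thresholds\<close>

fun prog_const :: "nat \<Rightarrow> program" where
  "prog_const 0 = Zero"
| "prog_const (Suc n) = Comp Succ [prog_const n]"

definition prog_add :: program where
  "prog_add = PrimRec (Proj 0) (Comp Succ [Proj 1])"

definition prog_mult :: program where
  "prog_mult = PrimRec Zero (Comp prog_add [Proj 1, Proj 2])"

definition prog_pow2 :: program where
  "prog_pow2 = PrimRec (prog_const 1) (Comp prog_add [Proj 1, Proj 1])"

lemma computes_comp1:
  "computes A g xs y \<Longrightarrow> computes A f [y] z \<Longrightarrow> computes A (Comp f [g]) xs z"
  by (rule computes.comp[where ys = "[y]"]) auto

lemma computes_comp2:
  "computes A g xs y \<Longrightarrow> computes A h xs y' \<Longrightarrow> computes A f [y, y'] z \<Longrightarrow> computes A (Comp f [g, h]) xs z"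
  by (rule computes.comp[where ys = "[y, y']"]) auto

lemma computes_proj: "i < length xs \<Longrightarrow> y = xs ! i \<Longrightarrow> computes A (Proj i) xs y"
  using computes.proj by simp

lemma computes_const: "computes A (prog_const c) xs c"
  by (induction c) (auto intro: computes.zero computes_comp1 computes.succ)

lemma computes_add: "computes A prog_add [x, y] (x + y)"
  unfolding prog_add_def
  by (induction x)
     (auto intro!: computes.primrec_0 computes.primrec_Suc computes_comp1 computes.succ computes_proj)

lemma computes_mult: "computes A prog_mult [x, y] (x * y)"
proof (induction x)
  case (Suc x)
  have "computes A prog_add [x * y, y] (x * y + y)" by (rule computes_add)
  then show ?case
    using Suc unfolding prog_mult_def
    by (auto intro!: computes.primrec_Suc computes_comp2 computes_proj simp: add.commute)
qed (auto simp: prog_mult_def intro: computes.primrec_0 computes.zero)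

lemma computes_pow2: "computes A prog_pow2 [x] (2 ^ x)"
proof (induction x)
  case (Suc x)
  have "computes A prog_add [2 ^ x, 2 ^ x] (2 ^ x + 2 ^ x)" by (rule computes_add)
  then show ?case
    using Suc unfolding prog_pow2_def
    by (auto intro!: computes.primrec_Suc computes_comp2 computes_proj simp: mult_2)
qed (use computes_const[of _ 1] in \<open>auto simp: prog_pow2_def intro: computes.primrec_0\<close>)

text \<open>
  The oracle call \<open>A 0 (4k)\<close> provides an argument beyond which \<open>\<nu> \<le> 1/(4k + 1)\<close>; the double
  exponential absorbs every other lower bound that is needed for \<open>Q\<close>.
\<close>
lemma threshold_computable:
  "\<exists>p. \<forall>A k. computes A p [k] (A 0 (4 * k) + 2 ^ 2 ^ (m * (k * k)))"
proof (intro exI allI)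
  fix A :: "nat \<Rightarrow> nat \<Rightarrow> nat" and k
  show "computes A (Comp prog_add [Comp (Query 0) [Comp prog_mult [prog_const 4, Proj 0]],
      Comp prog_pow2 [Comp prog_pow2 [Comp prog_mult [prog_const m, Comp prog_mult [Proj 0, Proj 0]]]]])
    [k] (A 0 (4 * k) + 2 ^ 2 ^ (m * (k * k)))"
    by (rule computes_comp2 computes_comp1 computes_const computes_proj computes.query
        computes_mult computes_pow2 computes_add | simp)+
qed

section \<open>Logarithmic derivatives of functions with few non-real zeros\<close>

text \<open>
  Up to the sign \<open>(-1)^j\<close>, this is the \<open>j\<close>-th Taylor coefficient of \<open>f'/f\<close> at \<open>z\<close>. With this sign a
  real zero of \<open>f\<close> to the left of a real \<open>z\<close> contributes a positive amount for every \<open>j\<close>.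
\<close>
definition log_deriv_coeff :: "nat \<Rightarrow> (complex \<Rightarrow> complex) \<Rightarrow> complex \<Rightarrow> complex" where
  "log_deriv_coeff j f z = (- 1) ^ j / fact j * (deriv ^^ j) (\<lambda>w. deriv f w / f w) z"

lemma open_nonzero:
  assumes "f holomorphic_on S" "open S"
  shows "open {w \<in> S. f w \<noteq> (0::complex)}"
proof -
  have "open (f -` (- {0}) \<inter> S)"
    using continuous_open_preimage[OF holomorphic_on_imp_continuous_on[OF assms(1)] assms(2)
        open_Compl[OF closed_singleton[of 0]]]
    by (simp add: Int_commute)
  also have "f -` (- {0}) \<inter> S = {w \<in> S. f w \<noteq> 0}" by auto
  finally show ?thesis .
qed

lemma log_deriv_coeff_cong:
  assumes "f holomorphic_on S" "open S" "z \<in> S" "f z \<noteq> 0" "\<And>w. w \<in> S \<Longrightarrow> f w = g w"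
  shows "log_deriv_coeff j f z = log_deriv_coeff j g z"
proof -
  have g: "g holomorphic_on S" using assms(1,5) holomorphic_transform by metis
  have d: "deriv f w = deriv g w" if "w \<in> S" for w
    using assms g that by (intro complex_derivative_transform_within_open)
  let ?U = "{w \<in> S. f w \<noteq> 0}"
  have U: "open ?U" by (rule open_nonzero) fact+
  have "(deriv ^^ j) (\<lambda>w. deriv f w / f w) z = (deriv ^^ j) (\<lambda>w. deriv g w / g w) z"
  proof (rule higher_deriv_transform_within_open[OF _ _ U])
    have "f holomorphic_on ?U" "g holomorphic_on ?U"
      using assms(1) g by (auto intro: holomorphic_on_subset)
    then show "(\<lambda>w. deriv f w / f w) holomorphic_on ?U" "(\<lambda>w. deriv g w / g w) holomorphic_on ?U"
      using U assms(5) by (auto intro!: holomorphic_intros)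
  qed (use assms d in auto)
  then show ?thesis by (simp add: log_deriv_coeff_def)
qed

lemma log_deriv_coeff_mult:
  assumes f: "f holomorphic_on S" and g: "g holomorphic_on S" and S: "open S" "z \<in> S"
    and nz: "f z \<noteq> 0" "g z \<noteq> 0"
  shows "log_deriv_coeff j (\<lambda>w. f w * g w) z = log_deriv_coeff j f z + log_deriv_coeff j g z"
proof -
  let ?U = "{w \<in> S. f w * g w \<noteq> 0}"
  have U: "open ?U" by (rule open_nonzero) (intro holomorphic_intros f g S)+
  have hol: "f holomorphic_on ?U" "g holomorphic_on ?U" 
    using f g by (auto intro: holomorphic_on_subset)
  have "(deriv ^^ j) (\<lambda>w. deriv (\<lambda>w. f w * g w) w / (f w * g w)) z
     = (deriv ^^ j) (\<lambda>w. deriv f w / f w + deriv g w / g w) z"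
  proof (rule higher_deriv_transform_within_open[OF _ _ U])
    show "deriv (\<lambda>w. f w * g w) w / (f w * g w) = deriv f w / f w + deriv g w / g w"
      if "w \<in> ?U" for w
    proof -
      have "deriv (\<lambda>w. f w * g w) w = f w * deriv g w + deriv f w * g w"
        using hol U that by (intro deriv_mult) (auto simp: holomorphic_on_imp_differentiable_at)
      then show ?thesis using that by (auto simp: field_simps)
    qed
  qed (use hol U nz S in \<open>auto intro!: holomorphic_intros\<close>)
  also have "\<dots> = (deriv ^^ j) (\<lambda>w. deriv f w / f w) z + (deriv ^^ j) (\<lambda>w. deriv g w / g w) z"
    by (rule higher_deriv_add[OF _ _ U]) (use hol U nz S in \<open>auto intro!: holomorphic_intros\<close>)
  finally show ?thesis by (simp add: log_deriv_coeff_def ring_distribs)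
qed

lemma log_deriv_coeff_const [simp]: "log_deriv_coeff j (\<lambda>_. c) z = 0"
  by (simp add: log_deriv_coeff_def)

lemma higher_deriv_inverse_linear:
  fixes z b :: complex
  assumes "z \<noteq> b"
  shows "(deriv ^^ j) (\<lambda>w. 1 / (w - b)) z = (- 1) ^ j * fact j / (z - b) ^ Suc j"
  using assms
proof (induction j arbitrary: z)
  case (Suc j)
  have "(deriv ^^ Suc j) (\<lambda>w. 1 / (w - b)) z = deriv (\<lambda>w. (- 1) ^ j * fact j / (w - b) ^ Suc j) z"
    unfolding funpow.simps o_def
  proof (rule complex_derivative_transform_within_open[of _ "- {b}"])
    show "(deriv ^^ j) (\<lambda>w. 1 / (w - b)) holomorphic_on - {b}"
      by (intro holomorphic_higher_deriv holomorphic_intros) auto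
    show "(\<lambda>w. (- 1) ^ j * fact j / (w - b) ^ Suc j) holomorphic_on - {b}"
      by (intro holomorphic_intros) auto
  qed (use Suc in auto)
  also have "\<dots> = (- 1) ^ Suc j * fact (Suc j) / (z - b) ^ Suc (Suc j)"
  proof (rule DERIV_imp_deriv)
    define c :: complex where "c = (- 1) ^ j * fact j"
    have nz: "z - b \<noteq> 0" using Suc.prems by simp
    have "((\<lambda>w. (w - b) ^ Suc j) has_field_derivative of_nat (Suc j) * (z - b) ^ j) (at z)"
      using DERIV_power[OF DERIV_diff[OF DERIV_ident DERIV_const[of b]], where n = "Suc j"] by simp
    then have "((\<lambda>w. c / (w - b) ^ Suc j) has_field_derivative
        (0 * (z - b) ^ Suc j - c * (of_nat (Suc j) * (z - b) ^ j)) / ((z - b) ^ Suc j * (z - b) ^ Suc j)) (at z)"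
      using nz by (intro DERIV_divide DERIV_const) auto
    also have "(0 * d ^ Suc j - c * (of_nat (Suc j) * d ^ j)) / (d ^ Suc j * d ^ Suc j)
        = (- 1) ^ Suc j * fact (Suc j) / d ^ Suc (Suc j)" if "d \<noteq> 0" for d
      using that by (simp add: c_def field_simps)
    note this[OF nz]
    finally show "((\<lambda>w. (- 1) ^ j * fact j / (w - b) ^ Suc j) has_field_derivative
        (- 1) ^ Suc j * fact (Suc j) / (z - b) ^ Suc (Suc j)) (at z)" by (simp add: c_def)
  qed
  finally show ?case .
qed simp

lemma log_deriv_coeff_linear:
  assumes "z \<noteq> b"
  shows "log_deriv_coeff j (\<lambda>w. w - b) z = 1 / (z - b) ^ Suc j"
proof -
  have "deriv (\<lambda>w. w - b) = (\<lambda>_. 1)"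
    by (auto intro!: DERIV_imp_deriv derivative_eq_intros)
  then show ?thesis
    using higher_deriv_inverse_linear[OF assms, of j]
    by (simp add: log_deriv_coeff_def power_mult_distrib[symmetric] flip: power_add)
qed

text \<open>
  The map \<open>u \<mapsto> u / (2A - u)\<close> sends the half-plane \<open>Re u < A\<close> into the unit disk and fixes 0, so the
  Schwarz lemma bounds it by \<open>1/2\<close> at half the radius; solving for \<open>u\<close> gives the bound.
\<close>
lemma borel_caratheodory_half_strict:
  assumes h: "h holomorphic_on ball z r" and r: "0 < r"
    and Re: "\<And>w. w \<in> ball z r \<Longrightarrow> Re (h w - h z) < A"
    and w: "norm (w - z) \<le> r / 2"
  shows "norm (h w - h z) \<le> 2 * A"
proof -
  have A: "0 < A" using Re[of z] r by simp
  define u where "u = (\<lambda>t. h (z + of_real r * t) - h z)"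
  define \<phi> where "\<phi> = (\<lambda>t. u t / (of_real (2 * A) - u t))"
  have mem: "z + of_real r * t \<in> ball z r" if "t \<in> ball 0 1" for t
    using that r by (simp add: dist_norm norm_mult)
  have Reu: "Re (u t) < A" if "t \<in> ball 0 1" for t
    using Re[OF mem[OF that]] by (simp add: u_def)
  have nz: "of_real (2 * A) - u t \<noteq> 0" if "t \<in> ball 0 1" for t
    using Reu[OF that] A by (auto simp: complex_eq_iff)
  have lt: "norm (u t) < norm (of_real (2 * A) - u t)" if "t \<in> ball 0 1" for t
  proof -
    have "(norm (u t))\<^sup>2 < (norm (of_real (2 * A) - u t))\<^sup>2"
      using mult_strict_left_mono[OF Reu[OF that], of "4 * A"] A
      unfolding cmod_power2 by (simp add: power2_eq_square algebra_simps)
    then show ?thesis by (rule power2_less_imp_less) simp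
  qed
  have uhol: "u holomorphic_on ball 0 1"
    unfolding u_def
    by (intro holomorphic_intros holomorphic_on_compose_gen[OF _ h, unfolded o_def]) (use mem in auto)
  have "\<phi> holomorphic_on ball 0 1"
    unfolding \<phi>_def by (intro holomorphic_intros uhol) (use nz in auto)
  moreover have "\<phi> 0 = 0" by (simp add: \<phi>_def u_def)
  moreover have "norm (\<phi> t) < 1" if "norm t < 1" for t
    using lt[of t] nz[of t] that by (simp add: \<phi>_def norm_divide)
  ultimately have S: "norm (\<phi> t) \<le> norm t" if "norm t < 1" for t
    using Schwarz_Lemma(1) that by blast
  define t where "t = (w - z) / of_real r"
  have t: "norm t \<le> 1 / 2" using w r by (simp add: t_def norm_divide field_simps)
  then have t1: "t \<in> ball 0 1" by simp
  have "norm (u t) / norm (of_real (2 * A) - u t) \<le> 1 / 2"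
    using order_trans[OF S[of t] t] t by (simp add: \<phi>_def norm_divide)
  moreover have "norm (of_real (2 * A) - u t) > 0" using nz[OF t1] by simp
  ultimately have "2 * norm (u t) \<le> norm (of_real (2 * A) - u t)" by (simp add: divide_simps)
  also have "\<dots> \<le> 2 * A + norm (u t)"
    using norm_triangle_ineq4[of "of_real (2 * A)" "u t"] A by simp
  finally have "norm (u t) \<le> 2 * A" by simp
  then show ?thesis using r by (simp add: u_def t_def)
qed

text \<open>
  A function without zeros in the disk is \<open>exp h\<close>, and \<open>Re (h - h z)\<close> is at most
  \<open>ln (M / |g z|)\<close>. The Borel-Caratheodory inequality bounds \<open>h - h z\<close> itself, and Cauchy's
  inequality at half the radius its Taylor coefficients.
\<close>
lemma log_deriv_coeff_nonzero_bound:
  assumes g: "g holomorphic_on ball z r" and r: "0 < r"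
    and nz: "\<And>w. w \<in> ball z r \<Longrightarrow> g w \<noteq> 0"
    and M: "\<And>w. w \<in> ball z r \<Longrightarrow> norm (g w) \<le> M"
  shows "norm (log_deriv_coeff j g z) \<le> 2 * real (Suc j) * (2 / r) ^ Suc j * ln (M / norm (g z))"
proof -
  obtain h where h: "h holomorphic_on ball z r" "\<And>w. w \<in> ball z r \<Longrightarrow> exp (h w) = g w"
    using holomorphic_logarithm_exists[of "ball z r" g z] g nz r by auto
  have zin: "z \<in> ball z r" using r by simp
  have Mpos: "0 < M" using M[OF zin] nz[OF zin] by (meson less_le_trans zero_less_norm_iff)
  have ReA: "Re (h w - h z) \<le> ln (M / norm (g z))" if "w \<in> ball z r" for w
  proof -
    have "exp (Re (h w - h z)) = norm (g w) / norm (g z)"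
      using h(2)[OF that] h(2)[OF zin] by (metis exp_diff norm_divide norm_exp_eq_Re)
    also have "\<dots> \<le> M / norm (g z)" using M[OF that] by (simp add: divide_right_mono)
    finally show ?thesis
      by (metis Mpos divide_pos_pos exp_gt_zero exp_le_cancel_iff exp_ln nz zero_less_norm_iff zin)
  qed
  have le: "norm (h w - h z) \<le> 2 * ln (M / norm (g z))" if "norm (w - z) \<le> r / 2" for w
  proof (rule field_le_epsilon)
    fix e :: real assume "0 < e"
    then have "norm (h w - h z) \<le> 2 * (ln (M / norm (g z)) + e / 2)"
      by (intro borel_caratheodory_half_strict[OF h(1) r _ that])
         (use ReA in \<open>force intro: le_less_trans\<close>)
    then show "norm (h w - h z) \<le> 2 * ln (M / norm (g z)) + e" by simp
  qed
  have sub: "cball z (r/2) \<subseteq> ball z r" using r by auto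
  have "norm ((deriv ^^ Suc j) (\<lambda>w. h w - h z) z) \<le> fact (Suc j) * (2 * ln (M / norm (g z))) / (r/2) ^ Suc j"
    by (rule Cauchy_inequality)
       (use r le sub h in \<open>auto intro!: holomorphic_intros continuous_intros holomorphic_on_imp_continuous_on
          intro: holomorphic_on_subset simp: norm_minus_commute\<close>)
  also have "(deriv ^^ Suc j) (\<lambda>w. h w - h z) z = (deriv ^^ Suc j) h z"
    using higher_deriv_diff[of h "ball z r" "\<lambda>_. h z" z "Suc j"] h zin by (simp del: funpow.simps)
  also have "(deriv ^^ Suc j) h z = (deriv ^^ j) (deriv h) z"
    by (simp add: funpow_Suc_right del: funpow.simps)
  also have "\<dots> = (deriv ^^ j) (\<lambda>w. deriv g w / g w) z"
  proof (rule higher_deriv_transform_within_open[of _ "ball z r"])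
    show "deriv h w = deriv g w / g w" if "w \<in> ball z r" for w
    proof -
      have "(h has_field_derivative deriv h w) (at w)"
        using h(1) that by (auto intro: holomorphic_derivI)
      then have "((\<lambda>w. exp (h w)) has_field_derivative exp (h w) * deriv h w) (at w)"
        by (auto intro!: derivative_eq_intros)
      then have "(g has_field_derivative exp (h w) * deriv h w) (at w)"
        by (rule has_field_derivative_transform_within_open[of _ _ _ "ball z r"]) (use h that in auto)
      then show ?thesis using h(2)[OF that] nz[OF that] by (simp add: DERIV_imp_deriv)
    qed
  qed (use h g nz zin in \<open>auto intro!: holomorphic_intros\<close>)
  finally have B: "norm ((deriv ^^ j) (\<lambda>w. deriv g w / g w) z)
    \<le> fact (Suc j) * (2 * ln (M / norm (g z))) / (r/2) ^ Suc j" .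
  have "norm (log_deriv_coeff j g z) = norm ((deriv ^^ j) (\<lambda>w. deriv g w / g w) z) / fact j"
    by (simp add: log_deriv_coeff_def norm_mult norm_divide norm_power)
  also have "\<dots> \<le> fact (Suc j) * (2 * ln (M / norm (g z))) / (r/2) ^ Suc j / fact j"
    by (rule divide_right_mono[OF B]) simp
  also have "\<dots> = 2 * real (Suc j) * (2 / r) ^ Suc j * ln (M / norm (g z))"
    by (simp add: power_divide field_simps del: power_Suc of_nat_Suc)
  finally show ?thesis .
qed

lemma factor_zero:
  assumes "f holomorphic_on S" "open S" "f a = 0"
  obtains g where "g holomorphic_on S" "\<And>w. w \<in> S \<Longrightarrow> f w = (w - a) * g w"
proof
  show "(\<lambda>z. if z = a then deriv f a else (f z - f a) / (z - a)) holomorphic_on S"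
    using pole_lemma_open assms by blast
qed (use assms in auto)

text \<open>
  A zero \<open>b\<close> in the small disk is divided out by means of the factor \<open>(s0 - b) / (s - b)\<close>. This
  keeps the value at \<open>s0\<close>, removes a positive term, and at least halves the bound on the circle
  because the circle is three times as large. So only finitely many zeros can be divided out, and the
  induction is on \<open>N\<close> with \<open>M < 2^N |g s0|\<close>: it ends with a function without zeros in the disk.
\<close>
lemma log_deriv_coeff_lower_bound:
  fixes s0 :: real
  assumes rR: "0 < r" "3 * r \<le> R" and S: "open S" "cball (of_real s0) R \<subseteq> S"
    and hol: "g holomorphic_on S" and g0: "g (of_real s0) \<noteq> 0"
    and M: "\<And>w. norm (w - of_real s0) = R \<Longrightarrow> norm (g w) \<le> M"
    and real: "\<And>w. w \<in> ball (of_real s0) r \<Longrightarrow> g w = 0 \<Longrightarrow> w \<in> \<real> \<and> Re w < s0"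
  shows "- (2 * real (Suc j) * (2 / r) ^ Suc j * ln (M / norm (g (of_real s0))))
           \<le> Re (log_deriv_coeff j g (of_real s0))"
proof -
  obtain N where "M / norm (g (of_real s0)) < 2 ^ N"
    using real_arch_pow[of 2 "M / norm (g (of_real s0))"] by auto
  then have N: "M < 2 ^ N * norm (g (of_real s0))" using g0 by (simp add: field_simps)
  have s0S: "of_real s0 \<in> S" using S(2) rR by (auto simp: subset_iff)
  have max: "norm (h w) \<le> B" if "h holomorphic_on S" "\<And>w. norm (w - of_real s0) = R \<Longrightarrow> norm (h w) \<le> B"
    "w \<in> cball (of_real s0) R" for h w B
  proof (rule maximum_modulus_frontier[of h "cball (of_real s0) R"])
    show "h holomorphic_on interior (cball (of_real s0) R)"
      using that(1) S(2) by (meson holomorphic_on_subset interior_subset subset_trans)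
    show "continuous_on (closure (cball (of_real s0) R)) h"
      using that(1) S(2) by (auto intro!: holomorphic_on_imp_continuous_on intro: holomorphic_on_subset)
    show "norm (h z) \<le> B" if "z \<in> frontier (cball (complex_of_real s0) R)" for z
      using that rR \<open>\<And>w. norm (w - of_real s0) = R \<Longrightarrow> norm (h w) \<le> B\<close>[of z]
      by (auto simp: dist_norm norm_minus_commute)
  qed (use that in auto)
  show ?thesis
    using N hol g0 M real
  proof (induction N arbitrary: g M)
    case 0
    have "norm (g (of_real s0)) \<le> M" by (rule max[OF 0(2,4)]) (use rR in auto)
    then show ?case using 0(1) by simp
  next
    case (Suc N)
    note hol = Suc.prems(2) and g0 = Suc.prems(3) and M = Suc.prems(4) and real = Suc.prems(5)
    show ?case
    proof (cases "\<exists>w \<in> ball (of_real s0) r. g w = 0")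
      case False
      have sub: "ball (of_real s0) r \<subseteq> S" using S(2) rR by (auto simp: subset_iff)
      have "norm (log_deriv_coeff j g (of_real s0))
          \<le> 2 * real (Suc j) * (2 / r) ^ Suc j * ln (M / norm (g (of_real s0)))"
        by (rule log_deriv_coeff_nonzero_bound)
           (use False rR holomorphic_on_subset[OF hol sub] max[OF hol M] in auto)
      then show ?thesis using abs_Re_le_cmod[of "log_deriv_coeff j g (of_real s0)"] by linarith
    next
      case True
      then obtain b' where b': "b' \<in> ball (of_real s0) r" "g b' = 0" by blast
      then obtain b where b: "b' = of_real b" "b < s0" using real by (metis Re_complex_of_real Reals_cases)
      have bd: "s0 - b < r" using b b' by (simp add: dist_norm flip: of_real_diff)
      obtain q where q: "q holomorphic_on S" "\<And>w. w \<in> S \<Longrightarrow> g w = (w - of_real b) * q w"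
        using factor_zero[OF hol S(1), of "of_real b"] b' b by auto
      define p where "p = (\<lambda>w. of_real (s0 - b) * q w)"
      have p: "p holomorphic_on S" unfolding p_def by (intro holomorphic_intros q)
      have p0: "p (of_real s0) = g (of_real s0)" using q(2)[OF s0S] by (simp add: p_def)
      have q0: "q (of_real s0) \<noteq> 0" using q(2)[OF s0S] g0 by auto
      have pM: "norm (p w) \<le> M / 2" if w: "norm (w - of_real s0) = R" for w
      proof -
        have wS: "w \<in> S" using S(2) w by (auto simp: dist_norm norm_minus_commute)
        have "R \<le> norm (w - of_real b) + norm (of_real b - complex_of_real s0)"
          using norm_triangle_ineq[of "w - of_real b" "of_real b - of_real s0"] w by simp
        also have "norm (of_real b - complex_of_real s0) = s0 - b" using b by (simp flip: of_real_diff)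
        finally have "2 * (s0 - b) \<le> norm (w - of_real b)" using bd rR by argo
        then have "2 * (s0 - b) * norm (q w) \<le> norm (w - of_real b) * norm (q w)"
          by (rule mult_right_mono) simp
        also have "\<dots> = norm (g w)" using q(2)[OF wS] by (simp add: norm_mult)
        also have "\<dots> \<le> M" by (rule M[OF w])
        finally show ?thesis using b by (simp add: p_def norm_mult algebra_simps del: of_real_diff)
      qed
      have IH: "- (2 * real (Suc j) * (2 / r) ^ Suc j * ln (M / 2 / norm (p (of_real s0))))
           \<le> Re (log_deriv_coeff j p (of_real s0))"
      proof (rule Suc.IH)
        show "M / 2 < 2 ^ N * norm (p (of_real s0))" using Suc.prems(1) p0 by simp
        show "w \<in> \<real> \<and> Re w < s0" if w: "w \<in> ball (of_real s0) r" "p w = 0" for w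
        proof (rule real[OF w(1)])
          have "w \<in> S" using w S(2) rR by auto
          then show "g w = 0" using w(2) q(2) b by (simp add: p_def)
        qed
      qed (use p p0 g0 pM in auto)
      have "norm (p (of_real s0)) \<le> M / 2" by (rule max[OF p pM]) (use rR in auto)
      then have Mpos: "0 < M" using p0 g0 by (metis half_gt_zero_iff less_le_trans zero_less_norm_iff)
      have "ln (M / 2 / norm (g (of_real s0))) \<le> ln (M / norm (g (of_real s0)))"
        using Mpos g0 by (simp add: field_simps)
      then have "2 * real (Suc j) * (2 / r) ^ Suc j * ln (M / 2 / norm (g (of_real s0)))
          \<le> 2 * real (Suc j) * (2 / r) ^ Suc j * ln (M / norm (g (of_real s0)))"
        using rR by (intro mult_left_mono) auto
      moreover have "log_deriv_coeff j g (of_real s0) =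
           log_deriv_coeff j (\<lambda>w. (w - of_real b) * q w) (of_real s0)"
        by (rule log_deriv_coeff_cong[OF hol S(1) s0S g0 q(2)])
      moreover have "\<dots> = log_deriv_coeff j (\<lambda>w. w - of_real b) (of_real s0) + log_deriv_coeff j q (of_real s0)"
        by (rule log_deriv_coeff_mult[of _ S]) (use b q0 q S s0S in \<open>auto intro!: holomorphic_intros\<close>)
      moreover have "log_deriv_coeff j p (of_real s0) = log_deriv_coeff j q (of_real s0)"
        unfolding p_def by (subst log_deriv_coeff_mult[of _ S]) (use b q0 q S s0S in \<open>auto intro!: holomorphic_intros\<close>)
      moreover have "0 \<le> Re (log_deriv_coeff j (\<lambda>w. w - of_real b) (of_real s0))"
      proof -
        have "log_deriv_coeff j (\<lambda>w. w - of_real b) (of_real s0) = of_real (1 / (s0 - b) ^ Suc j)"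
          using b by (subst log_deriv_coeff_linear) auto
        then show ?thesis using b by (simp del: of_real_divide of_real_power power_Suc)
      qed
      ultimately show ?thesis using IH p0 by simp
    qed
  qed
qed

section \<open>Dirichlet series in the half-plane of absolute convergence\<close>

definition dseries :: "(nat \<Rightarrow> complex) \<Rightarrow> complex \<Rightarrow> complex" where
  "dseries a s = (\<Sum>n. a (Suc n) / of_nat (Suc n) powr s)"

definition dsummable :: "(nat \<Rightarrow> complex) \<Rightarrow> bool" where
  "dsummable a \<longleftrightarrow> (\<forall>\<sigma>>1. summable (\<lambda>n. norm (a (Suc n)) / real (Suc n) powr \<sigma>))"

lemma norm_Suc_powr: "norm (of_nat (Suc n) powr s) = real (Suc n) powr Re s" for s :: complex
  using norm_powr_real_powr[of "of_nat (Suc n)" s] by (simp del: of_nat_Suc)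

lemma norm_dterm: "norm (c / of_nat (Suc n) powr s) = norm c / real (Suc n) powr Re s" for c s :: complex
  unfolding norm_divide norm_Suc_powr ..

lemma dseries_abs_summable:
  "dsummable a \<Longrightarrow> 1 < Re s \<Longrightarrow> summable (\<lambda>n. norm (a (Suc n) / of_nat (Suc n) powr s))"
  unfolding norm_dterm by (simp add: dsummable_def)

lemma dseries_sums:
  assumes "dsummable a" "1 < Re s"
  shows "(\<lambda>n. a (Suc n) / of_nat (Suc n) powr s) sums dseries a s"
  unfolding dseries_def by (rule summable_sums, rule summable_norm_cancel, rule dseries_abs_summable[OF assms])

lemma summable_Suc_powr: "1 < \<sigma> \<Longrightarrow> summable (\<lambda>n. 1 / real (Suc n) powr \<sigma>)"
  using summable_Suc_iff[of "\<lambda>n. real n powr (- \<sigma>)"] summable_real_powr_iff[of "- \<sigma>"]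
  by (simp add: powr_minus_divide del: of_nat_Suc)

lemma dsummable_bounded:
  assumes "\<And>n. norm (a n) \<le> C"
  shows "dsummable a"
  unfolding dsummable_def
proof (intro allI impI)
  fix \<sigma> :: real assume "1 < \<sigma>"
  then have "summable (\<lambda>n. C * (1 / real (Suc n) powr \<sigma>))"
    by (intro summable_mult summable_Suc_powr)
  then show "summable (\<lambda>n. norm (a (Suc n)) / real (Suc n) powr \<sigma>)"
    by (rule summable_comparison_test') (auto simp: divide_right_mono assms simp del: of_nat_Suc)
qed

text \<open>
  Since \<open>ln n\<close> grows more slowly than any power, it can be absorbed into half of the margin
  \<open>\<sigma> - 1\<close>.
\<close>
lemma dsummable_ln:
  assumes "dsummable a"
  shows "dsummable (\<lambda>n. a n * of_real (ln (real n)))"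
  unfolding dsummable_def
proof (intro allI impI)
  fix \<sigma> :: real assume s: "1 < \<sigma>"
  define d where "d = (\<sigma> - 1) / 2"
  have d: "0 < d" "\<sigma> - d > 1" using s by (auto simp: d_def field_simps)
  have "summable (\<lambda>n. (1 / d) * (norm (a (Suc n)) / real (Suc n) powr (\<sigma> - d)))"
    using assms d by (intro summable_mult) (auto simp: dsummable_def)
  then show "summable (\<lambda>n. norm (a (Suc n) * of_real (ln (real (Suc n)))) / real (Suc n) powr \<sigma>)"
  proof (rule summable_comparison_test')
    fix n :: nat
    have "ln (real (Suc n)) \<le> real (Suc n) powr d / d" using d by (intro ln_powr_bound) auto
    then have "norm (a (Suc n)) * ln (real (Suc n)) / real (Suc n) powr \<sigma>
        \<le> norm (a (Suc n)) * (real (Suc n) powr d / d) / real (Suc n) powr \<sigma>"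
      by (intro divide_right_mono mult_left_mono) auto
    also have "\<dots> = (1 / d) * (norm (a (Suc n)) / real (Suc n) powr (\<sigma> - d))"
      by (simp add: powr_diff del: of_nat_Suc)
    finally show "norm (norm (a (Suc n) * of_real (ln (real (Suc n)))) / real (Suc n) powr \<sigma>)
        \<le> (1 / d) * (norm (a (Suc n)) / real (Suc n) powr (\<sigma> - d))"
      by (simp add: norm_mult abs_mult del: of_nat_Suc)
  qed
qed

lemma dsummable_comparison:
  assumes "dsummable a" "\<And>n. norm (b n) \<le> norm (a n)"
  shows "dsummable b"
  unfolding dsummable_def
proof (intro allI impI)
  fix \<sigma> :: real assume s: "1 < \<sigma>"
  then have "summable (\<lambda>n. norm (a (Suc n)) / real (Suc n) powr \<sigma>)"
    using assms by (auto simp: dsummable_def)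
  then show "summable (\<lambda>n. norm (b (Suc n)) / real (Suc n) powr \<sigma>)"
    by (rule summable_comparison_test') (auto simp: divide_right_mono assms simp del: of_nat_Suc)
qed

lemma open_halfplane: "open {s. c < Re s}"
  by (simp add: open_halfspace_Re_gt)

lemma has_field_derivative_dterm:
  "((\<lambda>s. c / of_nat (Suc n) powr s) has_field_derivative
      - (c * of_real (ln (real (Suc n))) / of_nat (Suc n) powr s)) (at s)"
  for c s :: complex
proof -
  have "of_nat (Suc n) powr s \<noteq> 0" by (simp del: of_nat_Suc)
  moreover have "Ln (of_nat (Suc n)) = of_real (ln (real (Suc n)))"
    by (rule Ln_of_nat) simp
  ultimately show ?thesis
    by (auto intro!: derivative_eq_intros simp del: of_nat_Suc simp: field_simps)
qed

lemma has_field_derivative_dseries: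
  assumes a: "dsummable a" and s: "1 < Re s"
  shows "(dseries a has_field_derivative - dseries (\<lambda>n. a n * of_real (ln (real n))) s) (at s)"
proof -
  let ?S = "{s. 1 < Re s}"
  have "\<exists>g g'. \<forall>x \<in> ?S. ((\<lambda>n. a (Suc n) / of_nat (Suc n) powr x) sums g x) \<and>
      ((\<lambda>n. - (a (Suc n) * of_real (ln (real (Suc n))) / of_nat (Suc n) powr x)) sums g' x) \<and>
      (g has_field_derivative g' x) (at x)"
  proof (rule series_and_derivative_comparison_local[OF open_halfplane])
    fix x :: complex assume x: "x \<in> ?S"
    define \<sigma> where "\<sigma> = (1 + Re x) / 2"
    have \<sigma>: "1 < \<sigma>" "\<sigma> < Re x" using x by (auto simp: \<sigma>_def)
    show "\<exists>d h. 0 < d \<and> summable h \<and>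
       (\<forall>\<^sub>F n in sequentially. \<forall>y\<in>ball x d \<inter> ?S. norm (a (Suc n) / of_nat (Suc n) powr y) \<le> h n)"
    proof (intro exI conjI always_eventually allI ballI)
      show "0 < Re x - \<sigma>" using \<sigma> by simp
      show "summable (\<lambda>n. norm (a (Suc n)) / real (Suc n) powr \<sigma>)"
        using a \<sigma> by (auto simp: dsummable_def)
      fix n y assume "y \<in> ball x (Re x - \<sigma>) \<inter> ?S"
      then have "\<sigma> \<le> Re y"
        using abs_Re_le_cmod[of "x - y"] by (auto simp: dist_norm)
      then show "norm (a (Suc n) / of_nat (Suc n) powr y) \<le> norm (a (Suc n)) / real (Suc n) powr \<sigma>"
        unfolding norm_dterm by (intro divide_left_mono powr_mono) auto
    qed
  qed (rule has_field_derivative_dterm)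
  then obtain g g' where *: "\<forall>x \<in> ?S. ((\<lambda>n. a (Suc n) / of_nat (Suc n) powr x) sums g x) \<and>
      ((\<lambda>n. - (a (Suc n) * of_real (ln (real (Suc n))) / of_nat (Suc n) powr x)) sums g' x) \<and>
      (g has_field_derivative g' x) (at x)" by (elim exE)
  note g = *[rule_format, THEN conjunct1] *[rule_format, THEN conjunct2, THEN conjunct1]
    *[rule_format, THEN conjunct2, THEN conjunct2]
  have eq: "g x = dseries a x" if "x \<in> ?S" for x
    using g(1)[OF that] dseries_sums[OF a, of x] that sums_unique2 by blast
  have "(\<lambda>n. - (a (Suc n) * of_real (ln (real (Suc n))) / of_nat (Suc n) powr s)) sums
      (- dseries (\<lambda>n. a n * of_real (ln (real n))) s)"
    using sums_minus[OF dseries_sums[OF dsummable_ln[OF a] s]] by simp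
  then have "g' s = - dseries (\<lambda>n. a n * of_real (ln (real n))) s"
    using g(2)[of s] s sums_unique2 by blast
  then show ?thesis
    using has_field_derivative_transform_within_open[OF g(3) open_halfplane, of s 1 "dseries a"] s eq by auto
qed

lemma dseries_holomorphic: "dsummable a \<Longrightarrow> dseries a holomorphic_on {s. 1 < Re s}"
  using has_field_derivative_dseries by (subst holomorphic_on_open[OF open_halfplane]) blast

lemma higher_deriv_dseries:
  assumes "dsummable a" "1 < Re s"
  shows "(deriv ^^ j) (dseries a) s = (- 1) ^ j * dseries (\<lambda>n. a n * of_real (ln (real n) ^ j)) s"
  using assms
proof (induction j arbitrary: a)
  case (Suc j)
  let ?b = "\<lambda>n. a n * of_real (ln (real n))"
  have b: "dsummable ?b" by (rule dsummable_ln) fact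
  have "(deriv ^^ Suc j) (dseries a) s = (deriv ^^ j) (deriv (dseries a)) s"
    by (simp add: funpow_Suc_right del: funpow.simps)
  also have "\<dots> = (deriv ^^ j) (\<lambda>w. - dseries ?b w) s"
  proof (rule higher_deriv_transform_within_open[OF _ _ open_halfplane])
    show "deriv (dseries a) holomorphic_on {s. 1 < Re s}"
      by (intro holomorphic_deriv dseries_holomorphic Suc open_halfplane)
    show "(\<lambda>w. - dseries ?b w) holomorphic_on {s. 1 < Re s}"
      by (intro holomorphic_intros dseries_holomorphic b)
    show "deriv (dseries a) w = - dseries ?b w" if "w \<in> {s. 1 < Re s}" for w
      using has_field_derivative_dseries[OF Suc.prems(1), of w] that by (auto intro: DERIV_imp_deriv)
  qed (use Suc in auto)
  also have "\<dots> = - ((deriv ^^ j) (dseries ?b) s)"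
    by (rule higher_deriv_uminus[OF dseries_holomorphic[OF b] open_halfplane]) (use Suc in auto)
  also have "\<dots> = (- 1) ^ Suc j * dseries (\<lambda>n. a n * of_real (ln (real n) ^ Suc j)) s"
    using Suc.IH[OF b Suc.prems(2)] by (simp add: mult.assoc)
  finally show ?case .
qed simp

lemma dseries_has_sum:
  assumes "dsummable a" "1 < Re s"
  shows "((\<lambda>n. a n / of_nat n powr s) has_sum dseries a s) {1..}"
    and "(\<lambda>n. norm (a n / of_nat n powr s)) summable_on {1..}"
proof -
  have bij: "bij_betw Suc UNIV {1..}"
    by (rule bij_betwI[where g = "\<lambda>n. n - 1"]) auto
  have "((\<lambda>n. a (Suc n) / of_nat (Suc n) powr s) has_sum dseries a s) UNIV"
    by (rule norm_summable_imp_has_sum[OF dseries_abs_summable[OF assms] dseries_sums[OF assms]])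
  then show "((\<lambda>n. a n / of_nat n powr s) has_sum dseries a s) {1..}"
    by (rule iffD1[OF has_sum_reindex_bij_betw[OF bij]])
  have "(\<lambda>n. norm (a (Suc n) / of_nat (Suc n) powr s)) summable_on UNIV"
    by (rule norm_summable_imp_summable_on) (simp add: dseries_abs_summable[OF assms] del: of_nat_Suc)
  then show "(\<lambda>n. norm (a n / of_nat n powr s)) summable_on {1..}"
    by (rule iffD1[OF summable_on_reindex_bij_betw[OF bij]])
qed

text \<open>
  The product of the two absolutely convergent series is a sum over all pairs \<open>(d, e)\<close>; grouping
  the pairs by \<open>n = d e\<close> gives the series of the Dirichlet convolution.
\<close>
lemma dseries_convolution:
  assumes a: "dsummable a" and b: "dsummable b" and s: "1 < Re s"
    and c: "dsummable c" "\<And>n. 0 < n \<Longrightarrow> c n = (\<Sum>d | d dvd n. a d * b (n div d))"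
  shows "dseries c s = dseries a s * dseries b s"
proof -
  let ?f = "\<lambda>n. a n / of_nat n powr s" and ?g = "\<lambda>n. b n / of_nat n powr s"
  let ?P = "SIGMA n:{1::nat..}. {d. d dvd n}"
  have sum: "(\<lambda>(m, n). ?f m * ?g n) summable_on {1..} \<times> {1..}"
  proof (rule abs_summable_summable)
    have A: "(\<lambda>n. norm (?f n)) summable_on {1..}" and B: "(\<lambda>n. norm (?g n)) summable_on {1..}"
      by (rule dseries_has_sum(2)[OF a s] dseries_has_sum(2)[OF b s])+
    have "(\<lambda>x. norm (?f (fst x)) * norm (?g (snd x))) summable_on {1..} \<times> {1..}"
    proof (rule summable_on_SigmaI)
      show "((\<lambda>y. norm (?f (fst (x, y))) * norm (?g (snd (x, y))))
          has_sum norm (?f x) * (\<Sum>\<^sub>\<infinity>n\<in>{1..}. norm (?g n))) {1..}" for x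
        unfolding fst_conv snd_conv by (rule has_sum_cmult_right[OF has_sum_infsum[OF B]])
      show "(\<lambda>x. norm (?f x) * (\<Sum>\<^sub>\<infinity>n\<in>{1..}. norm (?g n))) summable_on {1..}"
        by (rule summable_on_cmult_left[OF A])
    qed (intro mult_nonneg_nonneg norm_ge_zero)
    then show "(\<lambda>x. norm (case x of (m, n) \<Rightarrow> ?f m * ?g n)) summable_on {1..} \<times> {1..}"
      unfolding case_prod_unfold norm_mult .
  qed
  have "((\<lambda>(m, n). ?f m * ?g n) has_sum (dseries a s * dseries b s)) ({1..} \<times> {1..})"
  proof (rule has_sum_SigmaI[OF _ _ sum])
    show "((\<lambda>n. (case (m, n) of (m, n) \<Rightarrow> ?f m * ?g n)) has_sum ?f m * dseries b s) {1..}" for m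
      unfolding prod.case by (rule has_sum_cmult_right[OF dseries_has_sum(1)[OF b s]])
    show "((\<lambda>m. ?f m * dseries b s) has_sum dseries a s * dseries b s) {1..}"
      by (rule has_sum_cmult_left[OF dseries_has_sum(1)[OF a s]])
  qed
  also have "?this \<longleftrightarrow> ((\<lambda>(n, d). ?f d * ?g (n div d)) has_sum (dseries a s * dseries b s)) ?P"
  proof (rule has_sum_reindex_bij_witness[where i = "\<lambda>(n, d). (d, n div d)" and j = "\<lambda>(m, n). (m * n, m)"])
    show "(\<lambda>(n, d). (d, n div d)) ((\<lambda>(m, n). (m * n, m)) x) = x" if "x \<in> {1..} \<times> {1..}" for x :: "nat \<times> nat"
      using that by (cases x) simp
    show "(\<lambda>(m, n). (m * n, m)) x \<in> ?P" if "x \<in> {1..} \<times> {1..}" for x :: "nat \<times> nat"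
      using that by (cases x) simp
    show "(\<lambda>(m, n). (m * n, m)) ((\<lambda>(n, d). (d, n div d)) x) = x" if "x \<in> ?P" for x
      using that by (cases x) simp
    show "(\<lambda>(n, d). (d, n div d)) x \<in> {1..} \<times> {1..}" if x: "x \<in> ?P" for x
    proof -
      obtain n d where "x = (n, d)" "0 < n" "d dvd n" using x by (cases x) simp
      then show ?thesis by (simp add: Suc_le_eq dvd_pos_nat dvd_imp_le div_greater_zero_iff)
    qed
    show "(\<lambda>(n, d). ?f d * ?g (n div d)) ((\<lambda>(m, n). (m * n, m)) x) = (\<lambda>(m, n). ?f m * ?g n) x"
      if "x \<in> {1..} \<times> {1..}" for x
      using that by (cases x) (simp only: prod.case mem_Times_iff fst_conv atLeast_iff nonzero_mult_div_cancel_left, simp)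
  qed (rule refl)
  finally have 1: "((\<lambda>(n, d). ?f d * ?g (n div d)) has_sum (dseries a s * dseries b s)) ?P" .
  have "((\<lambda>n. c n / of_nat n powr s) has_sum (dseries a s * dseries b s)) {1..}"
  proof (rule has_sum_SigmaD[OF 1])
    fix n :: nat assume "n \<in> {1..}"
    then have n: "0 < n" by simp
    have "((\<lambda>d. ?f d * ?g (n div d)) has_sum (\<Sum>d | d dvd n. ?f d * ?g (n div d))) {d. d dvd n}"
      using n by (intro has_sum_finite) auto
    also have "(\<Sum>d | d dvd n. ?f d * ?g (n div d)) = (\<Sum>d | d dvd n. a d * b (n div d) / of_nat n powr s)"
    proof (intro sum.cong refl)
      fix d assume "d \<in> {d. d dvd n}"
      then obtain e where e: "n = d * e" by (auto elim: dvdE)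
      then have "0 < d" "0 < e" using n by auto
      then show "?f d * ?g (n div d) = a d * b (n div d) / of_nat n powr s"
        using e powr_times_real[of "of_nat d" "of_nat e" s] by (simp add: field_simps)
    qed
    also have "\<dots> = c n / of_nat n powr s" using c(2)[OF n] by (simp add: sum_divide_distrib)
    finally show "((\<lambda>d. case (n, d) of (n, d) \<Rightarrow> ?f d * ?g (n div d)) has_sum c n / of_nat n powr s) {d. d dvd n}"
      by simp
  qed
  then show ?thesis
    using dseries_has_sum(1)[OF c(1) s] has_sum_unique by blast
qed

text \<open>
  The properties of a Dirichlet character on which the theory of its series in \<open>Re s > 1\<close> rests.
  Unlike characters to a fixed modulus, this class contains the constant 1 and is closed under products.
\<close>
definition cmult_bounded :: "(nat \<Rightarrow> complex) \<Rightarrow> bool" where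
  "cmult_bounded chi \<longleftrightarrow> chi 1 = 1 \<and> (\<forall>m n. chi (m * n) = chi m * chi n) \<and> (\<forall>n. norm (chi n) \<le> 1)"

lemma cmult_bounded_dsummable: "cmult_bounded chi \<Longrightarrow> dsummable chi"
  by (rule dsummable_bounded[of _ 1]) (simp add: cmult_bounded_def)

lemma dsummable_mangoldt:
  assumes "cmult_bounded chi"
  shows "dsummable (\<lambda>n. chi n * mangoldt n)"
proof (rule dsummable_comparison)
  show "dsummable (\<lambda>n. 1 * of_real (ln (real n)))"
    by (intro dsummable_ln dsummable_bounded[of _ 1]) simp
  show "norm (chi n * mangoldt n) \<le> norm (1 * of_real (ln (real n)) :: complex)" for n
  proof (cases "n = 0")
    case False
    then have "norm (chi n) * mangoldt n \<le> 1 * ln (real n)"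
      using assms mangoldt_le[of n] mangoldt_nonneg[of n] by (intro mult_mono) (auto simp: cmult_bounded_def)
    then show ?thesis using False by (simp add: norm_mult)
  qed simp
qed

text \<open>
  The identity \<open>\<Sum>d|n. \<Lambda>(d) = ln n\<close>, twisted by \<open>chi\<close>, says that \<open>-L'\<close> is the product of the
  series of \<open>chi \<Lambda>\<close> and \<open>L\<close>. The form without a quotient makes it available for proving that \<open>L\<close>
  has no zeros.
\<close>
lemma deriv_dseries_cmult:
  assumes chi: "cmult_bounded chi" and s: "1 < Re s"
  shows "deriv (dseries chi) s = - (dseries (\<lambda>n. chi n * mangoldt n) s * dseries chi s)"
proof -
  have "dseries (\<lambda>n. chi n * of_real (ln (real n))) s = dseries (\<lambda>n. chi n * mangoldt n) s * dseries chi s"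
  proof (rule dseries_convolution[OF dsummable_mangoldt[OF chi] cmult_bounded_dsummable[OF chi] s])
    show "dsummable (\<lambda>n. chi n * of_real (ln (real n)))"
      by (intro dsummable_ln cmult_bounded_dsummable chi)
    fix n :: nat assume "0 < n"
    then have "chi n * of_real (ln (real n)) = chi n * (\<Sum>d | d dvd n. mangoldt d)"
      by (simp only: mangoldt_sum)
    also have "\<dots> = (\<Sum>d | d dvd n. chi d * mangoldt d * chi (n div d))"
      unfolding sum_distrib_left
    proof (intro sum.cong refl)
      fix d assume "d \<in> {d. d dvd n}"
      then have "chi n = chi d * chi (n div d)"
        using chi dvd_mult_div_cancel[of d n] unfolding cmult_bounded_def by (metis mem_Collect_eq)
      then show "chi n * mangoldt d = chi d * mangoldt d * chi (n div d)" by simp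
    qed
    finally show "chi n * of_real (ln (real n)) = (\<Sum>d | d dvd n. chi d * mangoldt d * chi (n div d))" .
  qed
  then show ?thesis
    using DERIV_imp_deriv[OF has_field_derivative_dseries[OF cmult_bounded_dsummable[OF chi] s]] by simp
qed

text \<open>
  At 4 the terms after the first contribute at most \<open>(\<pi>\<^sup>2/6 - 1)/4\<close>, and already the crude
  \<open>\<pi> < 4\<close> makes this less than \<open>1/2\<close>. At 2 a sharper bound for \<open>\<pi>\<close> would be necessary.
\<close>
lemma dseries_at_4:
  assumes chi: "cmult_bounded chi"
  shows "1 / 2 \<le> norm (dseries chi 4)"
proof -
  let ?t = "\<lambda>n. chi (Suc n) / of_nat (Suc n) powr (4 :: complex)"
  have ds: "dsummable chi" by (rule cmult_bounded_dsummable) fact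
  have "?t sums dseries chi 4" by (rule dseries_sums[OF ds]) simp
  then have "?t sums (dseries chi 4 - ?t 0 + ?t 0)" by (simp only: diff_add_cancel)
  then have "(\<lambda>n. ?t (Suc n)) sums (dseries chi 4 - ?t 0)"
    by (rule iffD2[OF sums_Suc_iff])
  moreover have "?t 0 = 1" using chi by (simp add: cmult_bounded_def)
  ultimately have 1: "dseries chi 4 - 1 = (\<Sum>n. ?t (Suc n))"
    by (simp only: sums_unique)
  have quartic: "1 / m ^ 4 \<le> 1 / 4 * (1 / m ^ 2)" if "2 \<le> m" for m :: real
  proof -
    have "4 \<le> m ^ 2" using power_mono[OF that, of 2] by simp
    then show ?thesis by (simp add: field_simps power4_eq_xxxx power2_eq_square)
  qed
  have sm: "summable (\<lambda>n. norm (?t (Suc n)))"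
    by (rule iffD2[OF summable_Suc_iff[of "\<lambda>n. norm (?t n)"]], rule dseries_abs_summable[OF ds]) simp
  have "(\<lambda>n. 1 / real (Suc n) ^ 2) sums (pi\<^sup>2 / 6 - 1 + 1 / real (Suc 0) ^ 2)"
    using inverse_squares_sums by simp
  then have sq: "(\<lambda>n. 1 / real (Suc (Suc n)) ^ 2) sums (pi\<^sup>2 / 6 - 1)"
    by (rule iffD2[OF sums_Suc_iff])
  have "norm (dseries chi 4 - 1) \<le> (\<Sum>n. norm (?t (Suc n)))"
    unfolding 1 by (rule summable_norm[OF sm])
  also have "\<dots> \<le> (\<Sum>n. 1 / 4 * (1 / real (Suc (Suc n)) ^ 2))"
  proof (rule suminf_le[OF _ sm])
    show "summable (\<lambda>n. 1 / 4 * (1 / real (Suc (Suc n)) ^ 2))"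
      by (rule sums_summable[OF sums_mult[OF sq]])
    fix n :: nat
    have "norm (chi (Suc (Suc n))) \<le> 1" using chi by (simp add: cmult_bounded_def)
    then have le: "norm (?t (Suc n)) \<le> 1 / real (Suc (Suc n)) powr 4"
      unfolding norm_dterm complex_Re_numeral by (rule divide_right_mono) (rule powr_ge_zero)
    have eq: "1 / real (Suc (Suc n)) powr 4 = 1 / real (Suc (Suc n)) ^ 4"
      by (rule arg_cong[where f = "\<lambda>x. 1 / x"], rule powr_numeral) (rule of_nat_0_le_iff)
    have le': "1 / real (Suc (Suc n)) ^ 4 \<le> 1 / 4 * (1 / real (Suc (Suc n)) ^ 2)" by (rule quartic) simp
    show "norm (?t (Suc n)) \<le> 1 / 4 * (1 / real (Suc (Suc n)) ^ 2)" by (rule order_trans[OF le[unfolded eq] le'])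
  qed
  also have "\<dots> = 1 / 4 * (pi\<^sup>2 / 6 - 1)"
    by (rule sums_unique[OF sums_mult[OF sq], symmetric])
  also have "\<dots> \<le> 1 / 2"
  proof -
    have "pi\<^sup>2 \<le> 4\<^sup>2" using pi_less_4 by (intro power_mono) auto
    then show ?thesis by simp
  qed
  finally have "norm (dseries chi 4 - 1) \<le> 1 / 2" .
  moreover have "norm (1 :: complex) \<le> norm (1 - dseries chi 4) + norm (dseries chi 4)"
    using norm_triangle_ineq[of "1 - dseries chi 4" "dseries chi 4"] by simp
  ultimately show ?thesis by (simp only: norm_minus_commute[of 1] norm_one)
qed

text \<open>
  The equation \<open>L' = -D L\<close> with \<open>D\<close> holomorphic in a half-plane forces \<open>L = c exp (-\<integral>D)\<close>, and \<open>c\<close>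
  does not vanish because \<open>L 4\<close> does not.
\<close>
lemma dseries_nonzero:
  assumes chi: "cmult_bounded chi" and s: "1 < Re s"
  shows "dseries chi s \<noteq> 0"
proof -
  let ?S = "{s. 1 < Re s}"
  let ?D = "dseries (\<lambda>n. chi n * mangoldt n)"
  have conv: "convex ?S" by (rule convex_halfspace_Re_gt)
  obtain P where P: "\<And>x. x \<in> ?S \<Longrightarrow> (P has_field_derivative ?D x) (at x within ?S)"
    using holomorphic_convex_primitive'[OF conv open_halfplane dseries_holomorphic[OF dsummable_mangoldt[OF chi]]]
    by blast
  have "\<exists>c. \<forall>x\<in>?S. dseries chi x * exp (P x) = c"
  proof (rule has_field_derivative_zero_constant[OF conv])
    fix x assume x: "x \<in> ?S"
    have "(dseries chi has_field_derivative - (?D x * dseries chi x)) (at x within ?S)"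
    proof -
      have "dseries chi field_differentiable at x"
        using dseries_holomorphic[OF cmult_bounded_dsummable[OF chi]] open_halfplane x
        by (rule holomorphic_on_imp_differentiable_at)
      then have "(dseries chi has_field_derivative deriv (dseries chi) x) (at x)"
        by (simp only: DERIV_deriv_iff_field_differentiable)
      also have "deriv (dseries chi) x = - (?D x * dseries chi x)"
        using deriv_dseries_cmult[OF chi] x by simp
      finally show ?thesis by (rule has_field_derivative_at_within)
    qed
    then have "((\<lambda>x. dseries chi x * exp (P x)) has_field_derivative
        (- (?D x * dseries chi x) * exp (P x) + exp (P x) * ?D x * dseries chi x)) (at x within ?S)"
      by (rule DERIV_mult[OF _ DERIV_chain2[OF DERIV_exp P[OF x]]])
    also have "- (?D x * dseries chi x) * exp (P x) + exp (P x) * ?D x * dseries chi x = 0"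
      by (simp add: algebra_simps)
    finally show "((\<lambda>x. dseries chi x * exp (P x)) has_field_derivative 0) (at x within ?S)" .
  qed
  then obtain c where c: "\<And>x. x \<in> ?S \<Longrightarrow> dseries chi x * exp (P x) = c" by blast
  have "dseries chi 4 \<noteq> 0" using dseries_at_4[OF chi] by auto
  then have "c \<noteq> 0" using c[of 4] by auto
  then show ?thesis using c[of s] s by auto
qed

lemma log_deriv_coeff_dseries:
  assumes chi: "cmult_bounded chi" and s: "1 < Re s"
  shows "log_deriv_coeff j (dseries chi) s
           = - dseries (\<lambda>n. chi n * mangoldt n * of_real (ln (real n) ^ j)) s / fact j"
proof -
  let ?D = "dseries (\<lambda>n. chi n * mangoldt n)"
  have D: "?D holomorphic_on {s. 1 < Re s}"
    by (intro dseries_holomorphic dsummable_mangoldt chi)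
  have "(deriv ^^ j) (\<lambda>w. deriv (dseries chi) w / dseries chi w) s = (deriv ^^ j) (\<lambda>w. - ?D w) s"
  proof (rule higher_deriv_transform_within_open[OF _ _ open_halfplane])
    show "(\<lambda>w. deriv (dseries chi) w / dseries chi w) holomorphic_on {s. 1 < Re s}"
      by (intro holomorphic_intros dseries_holomorphic cmult_bounded_dsummable chi open_halfplane)
         (use dseries_nonzero[OF chi] in auto)
    show "(\<lambda>w. - ?D w) holomorphic_on {s. 1 < Re s}" by (intro holomorphic_intros D)
  qed (use s deriv_dseries_cmult[OF chi] dseries_nonzero[OF chi] in auto)
  also have "\<dots> = - ((deriv ^^ j) ?D s)"
    by (rule higher_deriv_uminus[OF D open_halfplane]) (use s in auto)
  also have "(deriv ^^ j) ?D s = (- 1) ^ j * dseries (\<lambda>n. chi n * mangoldt n * of_real (ln (real n) ^ j)) s"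
    by (rule higher_deriv_dseries[OF dsummable_mangoldt[OF chi] s])
  finally show ?thesis
    by (simp add: log_deriv_coeff_def flip: power_mult_distrib mult.assoc)
qed

text \<open>
  Removing the multiples of \<open>p\<close> is convolution with the function that is 1 at 1 and \<open>- c p\<close> at \<open>p\<close>.
\<close>
lemma dseries_remove_prime:
  assumes c: "cmult_bounded c" and p: "prime p" and s: "1 < Re s"
  shows "dseries (\<lambda>n. if p dvd n then 0 else c n) s = (1 - c p / of_nat p powr s) * dseries c s"
proof -
  let ?a = "\<lambda>n. if n = 1 then 1 else if n = p then - c p else 0"
  have p1: "p \<noteq> 1" "p > 0" using p prime_gt_0_nat by auto
  have na: "norm (?a n) \<le> 1" for n using c by (auto simp: cmult_bounded_def)
  have a: "dsummable ?a" by (rule dsummable_bounded[OF na])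
  have "dseries ?a s = 1 - c p / of_nat p powr s"
  proof -
    have "dseries ?a s = (\<Sum>n\<in>{0, p - 1}. ?a (Suc n) / of_nat (Suc n) powr s)"
      unfolding dseries_def by (rule suminf_finite) (use p1 in auto)
    also have "\<dots> = 1 - c p / of_nat p powr s" using p1 prime_gt_1_nat[OF p] by auto
    finally show ?thesis .
  qed
  moreover have "dseries (\<lambda>n. if p dvd n then 0 else c n) s = dseries ?a s * dseries c s"
  proof (rule dseries_convolution[OF a cmult_bounded_dsummable[OF c] s])
    show "dsummable (\<lambda>n. if p dvd n then 0 else c n)"
      by (rule dsummable_bounded[of _ 1]) (use c in \<open>auto simp: cmult_bounded_def\<close>)
    fix n :: nat assume n: "0 < n"
    have "(\<Sum>d | d dvd n. ?a d * c (n div d)) = (\<Sum>d\<in>{d. d dvd n} \<inter> {1, p}. ?a d * c (n div d))"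
      using n by (intro sum.mono_neutral_right) auto
    also have "\<dots> = (if p dvd n then 0 else c n)"
    proof (cases "p dvd n")
      case True
      then have "{d. d dvd n} \<inter> {1, p} = {1, p}" by auto
      moreover have "c n = c p * c (n div p)"
        using c True by (metis cmult_bounded_def dvd_mult_div_cancel)
      ultimately show ?thesis using True p1 by auto
    next
      case False
      then have "{d. d dvd n} \<inter> {1, p} = {1}" by auto
      then show ?thesis using False by simp
    qed
    finally show "(if p dvd n then 0 else c n) = (\<Sum>d | d dvd n. ?a d * c (n div d))" ..
  qed
  ultimately show ?thesis by simp
qed

section \<open>Continuation to the right half-plane\<close>

lemma convex_of_real_interval: "convex (complex_of_real ` {a..b})"
  by (rule convex_linear_image[OF _ convex_real_interval(5)]) (rule bounded_linear.linear[OF bounded_linear_of_real])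

text \<open>
  The mean value inequality for \<open>z powr (- s)\<close> on the real segment from \<open>a\<close> to \<open>a + 1\<close>.
\<close>
lemma powr_diff_bound:
  assumes a: "0 < a" and s: "0 < Re s" and t: "t \<in> {a..a + 1}"
  shows "norm (complex_of_real t powr (- s) - of_real a powr (- s)) \<le> norm s * a powr (- Re s - 1)"
proof -
  let ?S = "complex_of_real ` {a..a + 1}"
  have conv: "convex ?S" by (rule convex_of_real_interval)
  have "norm (complex_of_real t powr (- s) - of_real a powr (- s))
      \<le> norm s * a powr (- Re s - 1) * norm (complex_of_real t - of_real a)"
  proof (rule field_differentiable_bound[OF conv])
    fix z assume "z \<in> ?S"
    then obtain x where x: "z = of_real x" "a \<le> x" by auto
    show "((\<lambda>z. z powr (- s)) has_field_derivative (- s * z powr (- s - 1))) (at z within ?S)"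
      by (rule has_field_derivative_at_within, rule has_field_derivative_powr)
         (use x a in \<open>auto simp: complex_nonpos_Reals_iff\<close>)
    have "norm (- s * z powr (- s - 1)) = norm s * x powr (- Re s - 1)"
      using x a by (simp add: norm_mult norm_powr_real_powr)
    also have "\<dots> \<le> norm s * a powr (- Re s - 1)"
      using x a s by (intro mult_left_mono powr_mono2') auto
    finally show "norm (- s * z powr (- s - 1)) \<le> norm s * a powr (- Re s - 1)" .
  qed (use t a in auto)
  also have "\<dots> \<le> norm s * a powr (- Re s - 1) * 1"
    using t by (intro mult_left_mono) (auto simp flip: of_real_diff)
  finally show ?thesis by simp
qed

text \<open>
  The expression is the difference between \<open>(s - 1) a powr (- s)\<close> and the integral of
  \<open>(s - 1) x powr (- s)\<close> over \<open>[a, a + 1]\<close>. The factor \<open>s - 1\<close> makes it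
  entire in \<open>s\<close>.
\<close>
lemma powr_second_difference_bound:
  assumes a: "0 < a" and s: "0 < Re s"
  shows "norm ((s - 1) * of_real a powr (- s) - of_real a powr (1 - s) + of_real (a + 1) powr (1 - s))
           \<le> norm (s - 1) * norm s * a powr (- Re s - 1)"
proof -
  let ?S = "complex_of_real ` {a..a + 1}"
  let ?f = "\<lambda>z. z powr (1 - s) + (s - 1) * of_real a powr (- s) * (z - of_real a)"
  have conv: "convex ?S" by (rule convex_of_real_interval)
  have mem: "complex_of_real (a + 1) \<in> ?S" "complex_of_real a \<in> ?S"
    using a by (auto simp del: of_real_add)
  have le: "norm (?f (of_real (a + 1)) - ?f (of_real a))
      \<le> norm (s - 1) * norm s * a powr (- Re s - 1) * norm (complex_of_real (a + 1) - of_real a)"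
  proof (rule field_differentiable_bound[OF conv])
    fix z assume "z \<in> ?S"
    then obtain x where x: "z = of_real x" "x \<in> {a..a + 1}" by auto
    have "((\<lambda>z. z powr (1 - s)) has_field_derivative ((1 - s) * z powr (1 - s - 1))) (at z)"
      by (rule has_field_derivative_powr) (use x a in \<open>auto simp: complex_nonpos_Reals_iff\<close>)
    then have "(?f has_field_derivative ((1 - s) * z powr (1 - s - 1) + (s - 1) * of_real a powr (- s) * 1)) (at z)"
      by (intro DERIV_add DERIV_cmult) (auto intro!: derivative_eq_intros)
    also have "(1 - s) * z powr (1 - s - 1) + (s - 1) * of_real a powr (- s) * 1
        = (1 - s) * (z powr (- s) - of_real a powr (- s))"
      by (simp add: algebra_simps)
    finally show "(?f has_field_derivative (1 - s) * (z powr (- s) - of_real a powr (- s))) (at z within ?S)"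
      by (rule has_field_derivative_at_within)
    have "norm ((1 - s) * (z powr (- s) - of_real a powr (- s)))
        \<le> norm (1 - s) * (norm s * a powr (- Re s - 1))"
      unfolding norm_mult x(1) by (intro mult_left_mono powr_diff_bound[OF a s x(2)]) simp
    then show "norm ((1 - s) * (z powr (- s) - of_real a powr (- s)))
        \<le> norm (s - 1) * norm s * a powr (- Re s - 1)"
      by (simp add: norm_minus_commute mult.assoc)
  qed (rule mem)+
  have eq: "?f (of_real (a + 1)) - ?f (of_real a)
      = (s - 1) * of_real a powr (- s) - of_real a powr (1 - s) + of_real (a + 1) powr (1 - s)"
    by simp
  show ?thesis using le unfolding eq by simp
qed

text \<open>
  The common frame for both continuations: the terms decay like \<open>n powr (- Re s - 1)\<close>, uniformly on
  compact sets, so the series converges in the whole half-plane \<open>Re s > 0\<close>. On the disk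
  \<open>|s - 1| \<le> 3/4\<close> one has \<open>Re s \<ge> 1/4\<close> and \<open>1 + |s| \<le> 3\<close>, whence the constants.
\<close>
lemma halfplane_series:
  fixes f :: "nat \<Rightarrow> complex \<Rightarrow> complex"
  assumes hol: "\<And>n. f n holomorphic_on UNIV"
    and bound: "\<And>n s. 0 < Re s \<Longrightarrow> norm (f n s) \<le> B * (1 + norm s) ^ 2 * real (Suc n) powr (- Re s - 1)"
  shows "(\<lambda>s. \<Sum>n. f n s) holomorphic_on {s. 0 < Re s}"
    and "0 < Re s \<Longrightarrow> (\<lambda>n. f n s) sums (\<Sum>n. f n s)"
    and "s \<in> cball 1 (3/4) \<Longrightarrow> norm (\<Sum>n. f n s) \<le> 9 * B * (\<Sum>n. 1 / real (Suc n) powr (5/4))"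
proof -
  let ?S = "{s. 0 < Re s}"
  have "0 \<le> B * (1 + norm (1::complex)) ^ 2 * real (Suc 0) powr (- Re 1 - 1)"
    by (rule order_trans[OF norm_ge_zero bound]) simp
  then have B: "0 \<le> B" by simp
  have ub: "norm (f n y) \<le> B * (1 + K) ^ 2 * (1 / real (Suc n) powr \<sigma>)"
    if "norm y \<le> K" "0 < Re y" "\<sigma> \<le> Re y + 1" for n y K \<sigma>
  proof -
    have "real (Suc n) powr (- Re y - 1) \<le> real (Suc n) powr (- \<sigma>)"
      using that by (intro powr_mono) auto
    then have "norm (f n y) \<le> B * (1 + norm y) ^ 2 * real (Suc n) powr (- \<sigma>)"
      using B by (intro order_trans[OF bound[OF that(2)]] mult_left_mono) auto
    also have "\<dots> \<le> B * (1 + K) ^ 2 * real (Suc n) powr (- \<sigma>)"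
      using B that by (intro mult_right_mono mult_left_mono power_mono) auto
    finally show ?thesis by (simp add: powr_minus_divide del: of_nat_Suc)
  qed
  have "\<exists>g g'. \<forall>x \<in> ?S. ((\<lambda>n. f n x) sums g x) \<and> ((\<lambda>n. deriv (f n) x) sums g' x) \<and>
      (g has_field_derivative g' x) (at x)"
  proof (rule series_and_derivative_comparison_local[OF open_halfplane])
    show "(f n has_field_derivative deriv (f n) x) (at x)" for n x
      by (rule holomorphic_derivI[OF hol open_UNIV]) simp
    fix x :: complex assume x: "x \<in> ?S"
    show "\<exists>d h. 0 < d \<and> summable h \<and> (\<forall>\<^sub>F n in sequentially. \<forall>y\<in>ball x d \<inter> ?S. norm (f n y) \<le> h n)"
    proof (intro exI conjI always_eventually allI ballI)
      show "0 < Re x / 2" using x by simp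
      show "summable (\<lambda>n. B * (1 + (norm x + Re x / 2)) ^ 2 * (1 / real (Suc n) powr (1 + Re x / 2)))"
        by (rule summable_mult, rule summable_Suc_powr) (use x in simp)
      fix n y assume y: "y \<in> ball x (Re x / 2) \<inter> ?S"
      have "norm y \<le> norm x + Re x / 2"
        using y norm_triangle_ineq2[of y x] by (simp add: dist_norm norm_minus_commute)
      moreover have "Re x / 2 \<le> Re y"
      proof -
        have "norm (x - y) < Re x / 2" using y by (simp add: dist_norm)
        then show ?thesis using abs_Re_le_cmod[of "x - y"] by simp
      qed
      ultimately show "norm (f n y) \<le> B * (1 + (norm x + Re x / 2)) ^ 2 * (1 / real (Suc n) powr (1 + Re x / 2))"
        using y by (intro ub) auto
    qed
  qed
  then obtain g g' where *: "\<forall>x \<in> ?S. ((\<lambda>n. f n x) sums g x) \<and> ((\<lambda>n. deriv (f n) x) sums g' x) \<and>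
      (g has_field_derivative g' x) (at x)" by (elim exE)
  have g: "g x = (\<Sum>n. f n x)" if "0 < Re x" for x
    by (rule sums_unique) (use * that in blast)
  have "g holomorphic_on ?S"
    by (subst holomorphic_on_open[OF open_halfplane]) (use * in blast)
  then show "(\<lambda>s. \<Sum>n. f n s) holomorphic_on ?S"
    by (rule holomorphic_transform) (use g in simp)
  show "(\<lambda>n. f n s) sums (\<Sum>n. f n s)" if "0 < Re s"
    using * that g[OF that] by force
  show "norm (\<Sum>n. f n s) \<le> 9 * B * (\<Sum>n. 1 / real (Suc n) powr (5/4))" if s: "s \<in> cball 1 (3/4)"
  proof -
    have n: "norm s \<le> 2" using s norm_triangle_ineq2[of s 1] by (simp add: dist_norm norm_minus_commute)
    have r: "1 / 4 \<le> Re s" using s abs_Re_le_cmod[of "1 - s"] by (simp add: dist_norm)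
    have le: "norm (f k s) \<le> 9 * B * (1 / real (Suc k) powr (5/4))" for k
      using ub[OF n, of "5/4" k] r by (simp add: mult.commute)
    have sm: "summable (\<lambda>k. 9 * B * (1 / real (Suc k) powr (5/4)))"
      by (rule summable_mult, rule summable_Suc_powr) simp
    have "norm (\<Sum>n. f n s) \<le> (\<Sum>k. 9 * B * (1 / real (Suc k) powr (5/4)))"
      by (rule norm_suminf_le[OF le sm])
    also have "\<dots> = 9 * B * (\<Sum>n. 1 / real (Suc n) powr (5/4))"
      by (rule suminf_mult, rule summable_Suc_powr) simp
    finally show ?thesis .
  qed
qed

lemma divide_powr: "c / x powr s = c * x powr (- s)" for c x s :: complex
  by (simp add: powr_minus_divide)

lemma of_nat_powr_holomorphic: "(\<lambda>s. of_nat (Suc n) powr (c - s)) holomorphic_on A"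
  by (intro holomorphic_intros) (simp add: complex_nonpos_Reals_iff)

lemma abel_summation:
  fixes a u :: "nat \<Rightarrow> complex"
  shows "(\<Sum>n<N. a n * u n) = (\<Sum>n<N. (\<Sum>m<Suc n. a m) * (u n - u (Suc n))) + (\<Sum>m<N. a m) * u N"
  by (induction N) (simp_all add: algebra_simps)

text \<open>
  Partial summation moves the differences to the smooth factor \<open>n powr (- s)\<close>. So the series itself,
  not only its continuation, converges for \<open>Re s > 0\<close>.
\<close>
lemma dseries_bounded_partial_sums:
  assumes B: "\<And>N. norm (\<Sum>m<N. a (Suc m)) \<le> B"
  shows "dseries a holomorphic_on {s. 0 < Re s}"
    and "s \<in> cball 1 (3/4) \<Longrightarrow> norm (dseries a s) \<le> 9 * B * (\<Sum>n. 1 / real (Suc n) powr (5/4))"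
proof -
  define u where "u = (\<lambda>(s :: complex) n. (of_nat (Suc n) :: complex) powr (- s))"
  define f where "f = (\<lambda>n s. (\<Sum>m<Suc n. a (Suc m)) * (u s n - u s (Suc n)))"
  have hol: "f n holomorphic_on UNIV" for n
    unfolding f_def u_def
    using of_nat_powr_holomorphic[of _ 0] by (intro holomorphic_intros)
  have bound: "norm (f n s) \<le> B * (1 + norm s) ^ 2 * real (Suc n) powr (- Re s - 1)"
    if s: "0 < Re s" for n s
  proof -
    have "norm (u s n - u s (Suc n)) \<le> norm s * real (Suc n) powr (- Re s - 1)"
      using powr_diff_bound[of "real (Suc n)" s "real (Suc n) + 1"] s
      by (simp add: u_def norm_minus_commute add.commute)
    also have "\<dots> \<le> (1 + norm s) ^ 2 * real (Suc n) powr (- Re s - 1)"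
      by (intro mult_right_mono) (auto simp: power2_eq_square algebra_simps)
    finally have "norm (f n s) \<le> B * ((1 + norm s) ^ 2 * real (Suc n) powr (- Re s - 1))"
      unfolding f_def norm_mult
      by (intro mult_mono B) (auto intro: order_trans[OF norm_ge_zero B])
    then show ?thesis by (simp only: mult.assoc)
  qed
  note series = halfplane_series[of f B, OF hol bound]
  have eq: "dseries a s = (\<Sum>n. f n s)" if s: "0 < Re s" for s
  proof -
    have "(\<lambda>N. real (Suc N) powr (- Re s)) \<longlonglongrightarrow> 0"
      by (rule tendsto_neg_powr[OF _ filterlim_compose[OF filterlim_real_sequentially filterlim_Suc]]) (use s in simp)
    then have 0: "(\<lambda>N. B * real (Suc N) powr (- Re s)) \<longlonglongrightarrow> 0"
      by (rule tendsto_mult_right_zero)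
    have "(\<lambda>N. (\<Sum>m<N. a (Suc m)) * u s N) \<longlonglongrightarrow> 0"
    proof (rule Lim_null_comparison[OF always_eventually 0], rule allI)
      fix N
      have "norm (u s N) = real (Suc N) powr (- Re s)"
        unfolding u_def by (simp only: norm_Suc_powr uminus_complex.simps)
      then show "norm ((\<Sum>m<N. a (Suc m)) * u s N) \<le> B * real (Suc N) powr (- Re s)"
        unfolding norm_mult using B by (simp add: mult_right_mono)
    qed
    moreover have "(\<lambda>N. \<Sum>n<N. f n s) \<longlonglongrightarrow> (\<Sum>n. f n s)"
      using series(2)[OF _ s] by (simp only: sums_def)
    ultimately have "(\<lambda>N. (\<Sum>n<N. f n s) + (\<Sum>m<N. a (Suc m)) * u s N) \<longlonglongrightarrow> (\<Sum>n. f n s) + 0"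
      by (intro tendsto_add)
    also have "(\<lambda>N. (\<Sum>n<N. f n s) + (\<Sum>m<N. a (Suc m)) * u s N) = (\<lambda>N. \<Sum>n<N. a (Suc n) * u s n)"
      unfolding f_def by (rule ext, rule abel_summation[symmetric])
    finally have "(\<lambda>n. a (Suc n) * u s n) sums (\<Sum>n. f n s)"
      by (simp only: sums_def add_0_right)
    then show ?thesis
      unfolding dseries_def divide_powr u_def by (rule sums_unique[symmetric])
  qed
  show "dseries a holomorphic_on {s. 0 < Re s}"
    by (rule holomorphic_transform[OF series(1)]) (use eq in auto)
  show "norm (dseries a s) \<le> 9 * B * (\<Sum>n. 1 / real (Suc n) powr (5/4))" if s: "s \<in> cball 1 (3/4)"
  proof -
    have "0 < Re s" using s abs_Re_le_cmod[of "1 - s"] by (simp add: dist_norm)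
    then show ?thesis using series(3)[OF _ s] eq by simp
  qed
qed

text \<open>
  The function \<open>(s - 1) \<zeta>(s)\<close>, continued to \<open>Re s > 0\<close> by subtracting from \<open>\<Sum> n powr (- s)\<close> the
  integral \<open>\<integral> x powr (- s) dx\<close> over \<open>[1, \<infinity>)\<close>, piece by piece.
\<close>
definition zeta_reg :: "complex \<Rightarrow> complex" where
  "zeta_reg s = 1 + (\<Sum>n. (s - 1) * of_nat (Suc n) powr (- s)
       - of_nat (Suc n) powr (1 - s) + of_nat (Suc (Suc n)) powr (1 - s))"

lemma zeta_reg_series:
  shows "zeta_reg holomorphic_on {s. 0 < Re s}"
    and "0 < Re s \<Longrightarrow> (\<lambda>n. (s - 1) * of_nat (Suc n) powr (- s)
       - of_nat (Suc n) powr (1 - s) + of_nat (Suc (Suc n)) powr (1 - s)) sums (zeta_reg s - 1)"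
    and "s \<in> cball 1 (3/4) \<Longrightarrow> norm (zeta_reg s) \<le> 1 + 9 * (\<Sum>n. 1 / real (Suc n) powr (5/4))"
proof -
  define f where "f = (\<lambda>n (s :: complex). (s - 1) * of_nat (Suc n) powr (- s)
       - of_nat (Suc n) powr (1 - s) + of_nat (Suc (Suc n)) powr (1 - s))"
  have hol: "f n holomorphic_on UNIV" for n
    unfolding f_def
    using of_nat_powr_holomorphic[of n 0 UNIV] of_nat_powr_holomorphic[of _ 1 UNIV]
    by (intro holomorphic_intros)
  have bound: "norm (f n s) \<le> 1 * (1 + norm s) ^ 2 * real (Suc n) powr (- Re s - 1)"
    if s: "0 < Re s" for n s
  proof -
    have "norm (f n s) \<le> norm (s - 1) * norm s * real (Suc n) powr (- Re s - 1)"
      using powr_second_difference_bound[of "real (Suc n)" s] s by (simp add: f_def add.commute)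
    also have "\<dots> \<le> (1 + norm s) ^ 2 * real (Suc n) powr (- Re s - 1)"
      unfolding power2_eq_square
      using norm_triangle_ineq4[of s 1] by (intro mult_right_mono mult_mono) auto
    finally show ?thesis by simp
  qed
  have eq: "zeta_reg = (\<lambda>s. 1 + (\<Sum>n. f n s))" by (rule ext) (simp only: zeta_reg_def f_def)
  note series = halfplane_series[of f 1, OF hol bound]
  show "zeta_reg holomorphic_on {s. 0 < Re s}"
    unfolding eq by (intro holomorphic_intros series)
  show "(\<lambda>n. (s - 1) * of_nat (Suc n) powr (- s)
       - of_nat (Suc n) powr (1 - s) + of_nat (Suc (Suc n)) powr (1 - s)) sums (zeta_reg s - 1)" if "0 < Re s"
  proof -
    have "(\<lambda>n. f n s) sums (\<Sum>n. f n s)" by (rule series(2)[OF _ that])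
    then show ?thesis unfolding eq by (simp add: f_def)
  qed
  show "norm (zeta_reg s) \<le> 1 + 9 * (\<Sum>n. 1 / real (Suc n) powr (5/4))" if "s \<in> cball 1 (3/4)"
    unfolding eq using norm_triangle_ineq[of 1 "\<Sum>n. f n s"] series(3)[OF _ that] by simp
qed

lemma zeta_reg_1: "zeta_reg 1 = 1"
  by (simp add: zeta_reg_def powr_0 del: of_nat_Suc)

lemma zeta_reg_eq:
  assumes s: "1 < Re s"
  shows "zeta_reg s = (s - 1) * dseries (\<lambda>_. 1) s"
proof -
  define v where "v = (\<lambda>n. (of_nat (Suc n) :: complex) powr (1 - s))"
  have "(\<lambda>n. real (Suc n) powr (1 - Re s)) \<longlonglongrightarrow> 0"
    by (rule tendsto_neg_powr[OF _ filterlim_compose[OF filterlim_real_sequentially filterlim_Suc]]) (use s in simp)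
  then have "v \<longlonglongrightarrow> 0"
    by (rule Lim_null_comparison[OF always_eventually, rotated]) (simp add: v_def norm_Suc_powr del: of_nat_Suc)
  then have 1: "(\<lambda>n. v (Suc n) - v n) sums (0 - v 0)" by (rule telescope_sums)
  have "dsummable (\<lambda>_. 1)" by (rule dsummable_bounded[of _ 1]) simp
  from sums_mult[OF dseries_sums[OF this s], of "s - 1"]
  have 2: "(\<lambda>n. (s - 1) * of_nat (Suc n) powr (- s)) sums ((s - 1) * dseries (\<lambda>_. 1) s)"
    unfolding divide_powr by (simp only: mult_1_left)
  have eq: "(s - 1) * of_nat (Suc n) powr (- s) + (v (Suc n) - v n) = (s - 1) * of_nat (Suc n) powr (- s)
       - of_nat (Suc n) powr (1 - s) + of_nat (Suc (Suc n)) powr (1 - s)" for n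
    by (simp add: v_def del: of_nat_Suc)
  have s0: "0 < Re s" using s by simp
  have "zeta_reg s - 1 = (s - 1) * dseries (\<lambda>_. 1) s + (0 - v 0)"
    by (rule sums_unique2[OF zeta_reg_series(2)[OF s0] sums_add[OF 2 1, unfolded eq]])
  then show ?thesis by (simp add: v_def)
qed

section \<open>Real characters and their L-functions\<close>

lemma dirichlet_char_cong:
  assumes "dirichlet_char q chi" "[m = n] (mod q)"
  shows "chi m = chi n"
proof -
  have per: "chi (n + q * k) = chi n" for n k
  proof (induction k)
    case (Suc k)
    have "chi (n + q * Suc k) = chi ((n + q * k) + q)" by (simp add: algebra_simps)
    then show ?case using Suc assms(1) by (simp add: dirichlet_char_def)
  qed simp
  have red: "chi n = chi (n mod q)" for n using per[of "n mod q" "n div q"] by simp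
  show ?thesis using red[of m] red[of n] assms(2) by (simp add: cong_def)
qed

text \<open>
  A periodic function takes finitely many values, whereas the powers of a value of modulus greater
  than 1 would be unbounded.
\<close>
lemma dirichlet_char_cmult_bounded:
  assumes chi: "dirichlet_char q chi"
  shows "cmult_bounded chi"
  unfolding cmult_bounded_def
proof (intro conjI allI)
  have mult: "chi (m * n) = chi m * chi n" for m n using chi by (simp add: dirichlet_char_def)
  then show "chi (m * n) = chi m * chi n" for m n .
  have "chi 1 \<noteq> 0" using chi by (simp add: dirichlet_char_def)
  moreover have "chi 1 = chi 1 * chi 1" using mult[of 1 1] by simp
  ultimately show one: "chi 1 = 1" by simp
  fix n
  define M where "M = Max ((\<lambda>n. norm (chi n)) ` {..<q})"
  have q: "q > 0" using chi by (simp add: dirichlet_char_def)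
  have le: "norm (chi n) \<le> M" for n
  proof -
    have "chi n = chi (n mod q)" by (rule dirichlet_char_cong[OF chi]) (simp add: cong_def)
    then show ?thesis unfolding M_def using q by (intro Max_ge) auto
  qed
  have pow: "chi (n ^ k) = chi n ^ k" for k
    by (induction k) (use one mult in auto)
  show "norm (chi n) \<le> 1"
  proof (rule ccontr)
    assume "\<not> norm (chi n) \<le> 1"
    then obtain k where "M < norm (chi n) ^ k" using real_arch_pow[of "norm (chi n)" M] by auto
    then show False using le[of "n ^ k"] by (simp add: pow norm_power)
  qed
qed

text \<open>
  Multiplication by a residue \<open>a\<close> with \<open>chi a \<noteq> 1\<close> permutes the residues and multiplies the sum by
  \<open>chi a\<close>.
\<close>
lemma dirichlet_char_sum_period:
  assumes chi: "dirichlet_char q chi" and np: "\<not> principal_char q chi"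
  shows "(\<Sum>n<q. chi n) = 0"
proof -
  have q: "q > 0" using chi by (simp add: dirichlet_char_def)
  obtain a where a: "coprime a q" "chi a \<noteq> 1" using np chi by (auto simp: principal_char_def)
  have inj: "inj_on (\<lambda>n. (a * n) mod q) {..<q}"
  proof (rule inj_onI)
    fix x y assume xy: "x \<in> {..<q}" "y \<in> {..<q}" "(a * x) mod q = (a * y) mod q"
    then have "[a * x = a * y] (mod q)" by (simp add: cong_def)
    then have "[x = y] (mod q)" using a(1) by (simp add: cong_mult_lcancel_nat)
    then show "x = y" using xy by (simp add: cong_def)
  qed
  have "(\<lambda>n. (a * n) mod q) ` {..<q} = {..<q}"
    by (rule card_subset_eq) (use q card_image[OF inj] in auto)
  then have "(\<Sum>n<q. chi n) = (\<Sum>n<q. chi ((a * n) mod q))"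
    using sum.reindex[OF inj, of chi] by simp
  also have "\<dots> = (\<Sum>n<q. chi a * chi n)"
  proof (rule sum.cong[OF refl])
    fix n
    have "chi ((a * n) mod q) = chi (a * n)" by (rule dirichlet_char_cong[OF chi]) (simp add: cong_def)
    then show "chi ((a * n) mod q) = chi a * chi n" using chi by (simp add: dirichlet_char_def)
  qed
  also have "\<dots> = chi a * (\<Sum>n<q. chi n)" by (simp add: sum_distrib_left)
  finally show ?thesis using a(2) by simp
qed

text \<open>
  Complete periods contribute nothing, and an incomplete one has fewer than \<open>q\<close> terms.
\<close>
lemma dirichlet_char_partial_sums:
  assumes chi: "dirichlet_char q chi" and np: "\<not> principal_char q chi"
  shows "norm (\<Sum>m<N. chi (Suc m)) \<le> real q"
proof -
  have q: "q > 0" using chi by (simp add: dirichlet_char_def)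
  have per: "chi (n + q) = chi n" for n using chi by (simp add: dirichlet_char_def)
  have "(\<Sum>m<q. chi (Suc m)) + chi 0 = (\<Sum>m<q. chi m) + chi q"
    using sum.lessThan_Suc_shift[of chi q] by (simp add: add.commute)
  then have base: "(\<Sum>m<q. chi (Suc m)) = 0"
    using per[of 0] dirichlet_char_sum_period[OF chi np] by simp
  have shift: "(\<Sum>m<N + q. chi (Suc m)) = (\<Sum>m<N. chi (Suc m))" for N
  proof (induction N)
    case (Suc N)
    have "chi (Suc (N + q)) = chi (Suc N)" using per[of "Suc N"] by simp
    then show ?case using Suc by simp
  qed (use base in simp)
  show ?thesis
  proof (induction N rule: less_induct)
    case (less N)
    show ?case
    proof (cases "N < q")
      case True
      have "norm (\<Sum>m<N. chi (Suc m)) \<le> (\<Sum>m<N. 1)"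
        by (rule sum_norm_le) (use dirichlet_char_cmult_bounded[OF chi] in \<open>simp add: cmult_bounded_def\<close>)
      then show ?thesis using True by simp
    next
      case False
      then show ?thesis using less[of "N - q"] shift[of "N - q"] q by simp
    qed
  qed
qed

lemma dirichlet_char_trivial: "dirichlet_char 1 (\<lambda>_. 1)"
  by (simp add: dirichlet_char_def)

lemma dirichlet_char_modulus_1: "dirichlet_char 1 chi \<Longrightarrow> chi = (\<lambda>_. 1)"
  using dirichlet_char_cong[of 1 chi _ 1] dirichlet_char_cmult_bounded[of 1 chi]
  by (auto simp: cmult_bounded_def)

lemma primitive_principal_modulus:
  assumes "primitive_char q chi" "principal_char q chi"
  shows "q = 1"
proof -
  have "induced_by q chi 1 (\<lambda>_. 1)"
    using assms(2) dirichlet_char_trivial by (simp add: induced_by_def principal_char_def)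
  then show ?thesis using assms(1) by (auto simp: primitive_char_def)
qed

lemma induced_by_primitive:
  assumes chi: "dirichlet_char q chi"
  obtains d psi where "induced_by q chi d psi" "primitive_char d psi"
proof -
  let ?P = "\<lambda>d. \<exists>psi. induced_by q chi d psi"
  have "?P q" using chi by (auto simp: induced_by_def)
  then have P: "?P (LEAST d. ?P d)" by (rule LeastI)
  define d where "d = (LEAST d. ?P d)"
  obtain psi where psi: "induced_by q chi d psi" using P by (auto simp: d_def)
  have "primitive_char d psi"
    unfolding primitive_char_def
  proof (intro conjI allI impI)
    show "dirichlet_char d psi" using psi by (simp add: induced_by_def)
    fix e phi assume phi: "induced_by d psi e phi"
    have "coprime n d" if "coprime n q" for n
      using that psi by (auto simp: induced_by_def intro: coprime_divisors[of n n d q])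
    then have "induced_by q chi e phi"
      using psi phi unfolding induced_by_def by (auto intro: dvd_trans)
    then have "d \<le> e" unfolding d_def by (intro Least_le) auto
    moreover have "e \<le> d"
      using phi psi by (intro dvd_imp_le) (auto simp: induced_by_def dirichlet_char_def)
    ultimately show "e = d" by simp
  qed
  then show ?thesis using psi that by blast
qed

text \<open>
  Adding \<open>d\<close> times the product \<open>t\<close> of the primes that divide \<open>q\<close> but not \<open>n\<close> makes every prime
  divisor of \<open>q\<close> divide at most one of the two summands.
\<close>
lemma coprime_lift:
  fixes n d q :: nat
  assumes q: "0 < q" and d: "d dvd q" and n: "coprime n d"
  obtains n' where "[n' = n] (mod d)" "coprime n' q"
proof
  define t where "t = \<Prod>{p \<in> prime_factors q. \<not> p dvd n}"
  show "[n + d * t = n] (mod d)" by (simp add: cong_def)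
  show "coprime (n + d * t) q"
  proof (rule ccontr)
    assume "\<not> coprime (n + d * t) q"
    then have "gcd (n + d * t) q \<noteq> 1" by (simp only: coprime_iff_gcd_eq_1 not_False_eq_True)
    then obtain p where "prime p" "p dvd gcd (n + d * t) q" using prime_factor_nat by blast
    then have p: "prime p" "p dvd n + d * t" "p dvd q" by (simp_all only: gcd_greatest_iff)
    have pf: "p \<in> prime_factors q" using p q by (simp add: prime_factors_dvd)
    have td: "p dvd t \<longleftrightarrow> \<not> p dvd n"
    proof
      assume "p dvd t"
      then obtain r where r: "r \<in> prime_factors q" "\<not> r dvd n" "p dvd r"
        using p(1) unfolding t_def by (subst (asm) prime_dvd_prod_iff) auto
      then have "r = p" using p(1) primes_dvd_imp_eq[of p r] by auto
      then show "\<not> p dvd n" using r by simp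
    next
      assume "\<not> p dvd n"
      then show "p dvd t" unfolding t_def using pf by (intro dvd_prodI) auto
    qed
    show False
    proof (cases "p dvd n")
      case True
      then have "p dvd d * t" using p(2) dvd_add_right_iff by blast
      then have "p dvd d" using td True p(1) by (simp add: prime_dvd_mult_iff)
      then have "is_unit p" using coprime_common_divisor[OF n True] by simp
      then show False using p(1) not_prime_unit by blast
    next
      case False
      then have "p dvd d * t" using td by simp
      then show False using p(2) False dvd_add_left_iff by blast
    qed
  qed
qed

lemma induced_by_real:
  assumes ind: "induced_by q chi d psi" and q: "0 < q" and real: "\<And>n. chi n \<in> \<real>"
  shows "psi n \<in> \<real>"
proof (cases "coprime n d")
  case True
  obtain n' where n': "[n' = n] (mod d)" "coprime n' q"
    using coprime_lift[OF q _ True] ind by (auto simp: induced_by_def)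
  then have "psi n = chi n'"
    using ind dirichlet_char_cong[of d psi n' n] by (auto simp: induced_by_def)
  then show ?thesis using real by simp
next
  case False
  then have "psi n = 0" using ind by (auto simp: induced_by_def dirichlet_char_def)
  then show ?thesis by simp
qed

text \<open>
  The Chinese remainder theorem for moduli that need not be coprime.
\<close>
lemma cong_combine:
  fixes a b :: nat
  assumes q: "0 < q1" "0 < q2" and ab: "[a = b] (mod gcd q1 q2)"
  obtains m where "[m = a] (mod q1)" "[m = b] (mod q2)"
proof -
  \<comment> \<open>Replacing \<open>b\<close> by a larger representative avoids truncated subtraction.\<close>
  define c where "c = b + q2 * a"
  have ca: "a \<le> c" using q by (simp add: c_def trans_le_add2)
  have "[a = c] (mod gcd q1 q2)"
    using ab by (simp add: c_def cong_def mod_add_eq mult.commute)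
       (metis gcd_dvd2 mod_add_right_eq dvd_imp_mod_0 dvd_mult add_0_right mult.commute)
  then have "gcd q1 q2 dvd c - a" using ca by (metis cong_altdef_nat cong_sym)
  then obtain e where e: "c - a = gcd q1 q2 * e" by (auto elim: dvdE)
  obtain x where x: "[q1 * x = gcd q1 q2] (mod q2)" using cong_solve_nat[of q1 q2] q by auto
  have "[q1 * x * e = c - a] (mod q2)" unfolding e by (rule cong_mult[OF x cong_refl])
  then have "[a + q1 * x * e = a + (c - a)] (mod q2)" by (rule cong_add[OF cong_refl])
  then have "[a + q1 * x * e = c] (mod q2)" using ca by simp
  moreover have "[c = b] (mod q2)" by (simp add: c_def cong_def)
  ultimately have "[a + q1 * x * e = b] (mod q2)" by (rule cong_trans)
  moreover have "[a + q1 * x * e = a] (mod q1)" by (simp add: cong_def mult.assoc)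
  ultimately show ?thesis using that by blast
qed

lemma coprime_cong: "[a = b] (mod q) \<Longrightarrow> coprime a q \<Longrightarrow> coprime b q" for a b q :: nat
  by (metis cong_imp_coprime)

text \<open>
  Let \<open>d\<close> be the greatest common divisor of the moduli. If \<open>a\<close> and \<open>b\<close> are congruent modulo \<open>d\<close>,
  some \<open>m\<close> is congruent to \<open>a\<close> modulo \<open>q1\<close> and to \<open>b\<close> modulo \<open>q2\<close>, so \<open>chi1 a = chi1 m = chi2 m = chi2 b\<close>.
  Hence both values depend only on the residue modulo \<open>d\<close>: the two characters are induced by one
  character modulo \<open>d\<close>, and primitivity gives \<open>d = q1 = q2\<close>.
\<close>
lemma primitive_char_eqI:
  assumes c1: "primitive_char q1 chi1" and c2: "primitive_char q2 chi2"
    and eq: "\<And>n. coprime n (q1 * q2) \<Longrightarrow> chi1 n = chi2 n"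
  shows "q1 = q2 \<and> chi1 = chi2"
proof -
  have d1: "dirichlet_char q1 chi1" and d2: "dirichlet_char q2 chi2"
    using c1 c2 by (simp_all add: primitive_char_def)
  have q: "0 < q1" "0 < q2" using d1 d2 by (simp_all add: dirichlet_char_def)
  define d where "d = gcd q1 q2"
  have dq: "d dvd q1" "d dvd q2" by (simp_all add: d_def)
  have dpos: "0 < d" using q by (simp add: d_def)
  have down: "[a = b] (mod d)" if "[a = b] (mod q1) \<or> [a = b] (mod q2)" for a b
    using that dq by (auto intro: cong_dvd_modulus_nat)
  have lift1: "\<exists>a'. [a' = a] (mod q1) \<and> coprime a' (q1 * q2)" if "coprime a q1" for a
    using coprime_lift[of "q1 * q2" q1 a] q that by (metis dvd_triv_left nat_0_less_mult_iff)
  have cross: "chi1 a = chi2 b" if ab: "[a = b] (mod d)" and a: "coprime a q1" and b: "coprime b q2" for a b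
  proof -
    obtain m where m: "[m = a] (mod q1)" "[m = b] (mod q2)"
      using cong_combine[OF q] ab unfolding d_def by blast
    have "coprime m (q1 * q2)" using coprime_cong[OF cong_sym[OF m(1)] a] coprime_cong[OF cong_sym[OF m(2)] b] by simp
    then have "chi1 m = chi2 m" by (rule eq)
    then show ?thesis using dirichlet_char_cong[OF d1 m(1)] dirichlet_char_cong[OF d2 m(2)] by simp
  qed
  have wd: "chi1 a = chi1 b" if ab: "[a = b] (mod d)" and a: "coprime a q1" and b: "coprime b q1" for a b
  proof -
    \<comment> \<open>Two arguments of \<open>chi1\<close> are compared by way of \<open>chi2\<close>, so one of them has to be coprime to \<open>q2\<close>.\<close>
    obtain b' where b': "[b' = b] (mod q1)" "coprime b' (q1 * q2)" using lift1[OF b] by blast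
    have "[b' = b] (mod d)" using down b'(1) by blast
    then have "[a = b'] (mod d)" using ab by (meson cong_sym cong_trans)
    then have "chi1 a = chi2 b'" using b'(2) by (intro cross a) auto
    also have "\<dots> = chi1 b'" using eq b'(2) by simp
    also have "\<dots> = chi1 b" by (rule dirichlet_char_cong[OF d1 b'(1)])
    finally show ?thesis .
  qed
  define l where "l = (\<lambda>n. SOME n'. [n' = n] (mod d) \<and> coprime n' q1)"
  have l: "[l n = n] (mod d)" "coprime (l n) q1" if n: "coprime n d" for n
  proof -
    obtain n' where "[n' = n] (mod d)" "coprime n' q1" using coprime_lift[OF q(1) dq(1) n] .
    then have "\<exists>n'. [n' = n] (mod d) \<and> coprime n' q1" by blast
    from someI_ex[OF this] show "[l n = n] (mod d)" "coprime (l n) q1" by (simp_all add: l_def)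
  qed
  define psi where "psi = (\<lambda>n. if coprime n d then chi1 (l n) else 0)"
  have psi: "dirichlet_char d psi"
    unfolding dirichlet_char_def
  proof (intro conjI allI)
    show "0 < d" by fact
    show "psi (m * n) = psi m * psi n" for m n
    proof (cases "coprime m d \<and> coprime n d")
      case True
      have "chi1 (l (m * n)) = chi1 (l m * l n)"
      proof (rule wd)
        have "[l (m * n) = m * n] (mod d)" using True by (intro l) auto
        moreover have "[l m * l n = m * n] (mod d)" using True by (intro cong_mult l) auto
        ultimately show "[l (m * n) = l m * l n] (mod d)" by (meson cong_sym cong_trans)
      qed (use True l in auto)
      then show ?thesis using True d1 by (simp add: psi_def dirichlet_char_def)
    qed (auto simp: psi_def)
    show "psi (n + d) = psi n" for n
    proof (cases "coprime n d")
      case True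
      then have T: "coprime (n + d) d" by (simp add: coprime_iff_gcd_eq_1)
      have "chi1 (l (n + d)) = chi1 (l n)"
      proof (rule wd)
        have "[l (n + d) = n] (mod d)" using l(1)[OF T] by (simp add: cong_def)
        then show "[l (n + d) = l n] (mod d)" using l(1)[OF True] by (meson cong_sym cong_trans)
      qed (use True T l in auto)
      then show ?thesis using True T by (simp add: psi_def)
    qed (simp add: psi_def coprime_iff_gcd_eq_1)
    show "psi n \<noteq> 0 \<longleftrightarrow> coprime n d" for n
      by (cases "coprime n d") (use l(2)[of n] d1 in \<open>auto simp: psi_def dirichlet_char_def\<close>)
  qed
  have cd: "coprime n d" if "coprime n q1 \<or> coprime n q2" for n
    using that dq by (meson coprime_divisors dvd_refl)
  have "induced_by q1 chi1 d psi"
    unfolding induced_by_def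
  proof (intro conjI allI impI psi dq)
    fix n assume n: "coprime n q1"
    then have c: "coprime n d" using cd by blast
    show "chi1 n = psi n" using wd[OF cong_sym[OF l(1)[OF c]] n l(2)[OF c]] c by (simp add: psi_def)
  qed
  then have e1: "d = q1" using c1 by (auto simp: primitive_char_def)
  have "induced_by q2 chi2 d psi"
    unfolding induced_by_def
  proof (intro conjI allI impI psi dq)
    fix n assume n: "coprime n q2"
    then have c: "coprime n d" using cd by blast
    show "chi2 n = psi n" using cross[OF l(1)[OF c] l(2)[OF c] n] c by (simp add: psi_def)
  qed
  then have e2: "d = q2" using c2 by (auto simp: primitive_char_def)
  have "chi1 n = chi2 n" for n
  proof (cases "coprime n q1")
    case True then show ?thesis using eq e1 e2 by simp
  next
    case False then show ?thesis using d1 d2 e1 e2 by (metis dirichlet_char_def)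
  qed
  then show ?thesis using e1 e2 by auto
qed

lemma dirichlet_char_mult:
  assumes "dirichlet_char q1 chi1" "dirichlet_char q2 chi2"
  shows "dirichlet_char (q1 * q2) (\<lambda>n. chi1 n * chi2 n)"
  unfolding dirichlet_char_def
proof (intro conjI allI)
  show "chi1 (n + q1 * q2) * chi2 (n + q1 * q2) = chi1 n * chi2 n" for n
    using dirichlet_char_cong[OF assms(1), of "n + q1 * q2" n] dirichlet_char_cong[OF assms(2), of "n + q1 * q2" n]
    by (simp add: cong_def)
qed (use assms in \<open>auto simp: dirichlet_char_def\<close>)

text \<open>
  Where \<open>chi1 chi2 = 1\<close>, two real values of modulus at most 1 must both be 1 or both be -1, so the
  characters agree on all residues coprime to \<open>q1 q2\<close>.
\<close>
lemma product_nonprincipal: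
  assumes c1: "primitive_char q1 chi1" and c2: "primitive_char q2 chi2"
    and real: "\<And>n. chi1 n \<in> \<real>" "\<And>n. chi2 n \<in> \<real>" and ne: "(q1, chi1) \<noteq> (q2, chi2)"
  shows "\<not> principal_char (q1 * q2) (\<lambda>n. chi1 n * chi2 n)"
proof
  assume P: "principal_char (q1 * q2) (\<lambda>n. chi1 n * chi2 n)"
  have "chi1 n = chi2 n" if "coprime n (q1 * q2)" for n
  proof -
    have one: "chi1 n * chi2 n = 1" using P that by (simp add: principal_char_def)
    have b: "norm (chi1 n) \<le> 1" "norm (chi2 n) \<le> 1"
      using c1 c2 dirichlet_char_cmult_bounded by (auto simp: primitive_char_def cmult_bounded_def)
    obtain x y where xy: "chi1 n = of_real x" "chi2 n = of_real y" using real by (meson Reals_cases)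
    have "x * y = 1" using one xy by (metis of_real_eq_1_iff of_real_mult)
    moreover have "\<bar>x\<bar> \<le> 1" "\<bar>y\<bar> \<le> 1" using b xy by auto
    moreover have "0 \<le> (x - y) ^ 2" by simp
    moreover have "x\<^sup>2 \<le> 1" "y\<^sup>2 \<le> 1" using calculation by (simp_all add: abs_square_le_1)
    ultimately have "(x - y) ^ 2 = 0" by (simp add: power2_diff)
    then show ?thesis using xy by simp
  qed
  then have "q1 = q2 \<and> chi1 = chi2" by (rule primitive_char_eqI[OF c1 c2])
  then show False using ne by simp
qed

text \<open>
  Two continuations agree for \<open>Re s > 1\<close>, hence on the smaller of their half-planes, which stays
  connected when the point 1 is removed.
\<close>
lemma dirichlet_L_eqI:
  assumes F: "continues_L q chi 0 F" and s: "0 < Re s" and s1: "principal_char q chi \<Longrightarrow> s \<noteq> 1"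
  shows "dirichlet_L q chi s = F s"
  unfolding dirichlet_L_def
proof (rule the_equality)
  show "\<exists>c F'. c < Re s \<and> continues_L q chi c F' \<and> F s = F' s" using F s by blast
next
  fix z assume "\<exists>c F'. c < Re s \<and> continues_L q chi c F' \<and> z = F' s"
  then obtain c G where G: "c < Re s" "continues_L q chi c G" "z = G s" by blast
  define P where "P = (if principal_char q chi then {1 :: complex} else {})"
  define U where "U = {w. max 0 c < Re w} - P"
  have oU: "open U" unfolding U_def P_def by (intro open_Diff open_halfplane) auto
  have "connected {w. max 0 c < Re w}" by (intro convex_connected convex_halfspace_Re_gt)
  then have cU: "connected U"
    unfolding U_def P_def by (simp add: connected_open_delete[OF open_halfplane] del: max_less_iff_conj)
  have "z = F s" unfolding G(3)
  proof (rule analytic_continuation_open[where s = "{w. max 1 c < Re w}" and s' = U and f = G and g = F])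
    show "{w. max 1 c < Re w} \<noteq> {}"
    proof -
      have "complex_of_real (max 1 c + 1) \<in> {w. max 1 c < Re w}" by (simp del: max_less_iff_conj)
      then show ?thesis by blast
    qed
    show "{w. max 1 c < Re w} \<subseteq> U" unfolding U_def P_def by auto
    show "G holomorphic_on U" "F holomorphic_on U"
      using G(2) F unfolding continues_L_def U_def P_def by (auto elim!: holomorphic_on_subset)
    show "G w = F w" if w: "w \<in> {w. max 1 c < Re w}" for w
    proof -
      have w1: "1 < Re w" using w by simp
      have "(\<lambda>n. chi (Suc n) / of_nat (Suc n) powr w) sums G w"
        using G(2) w1 unfolding continues_L_def by blast
      moreover have "(\<lambda>n. chi (Suc n) / of_nat (Suc n) powr w) sums F w"
        using F w1 unfolding continues_L_def by blast
      ultimately show ?thesis by (rule sums_unique2)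
    qed
    show "s \<in> U" using s G(1) s1 by (auto simp: U_def P_def)
  qed (rule open_halfplane oU cU)+
  then show "z = F s" .
qed

lemma dirichlet_L_nonprincipal:
  assumes chi: "dirichlet_char q chi" and np: "\<not> principal_char q chi" and s: "0 < Re s"
  shows "dirichlet_L q chi s = dseries chi s"
proof (rule dirichlet_L_eqI[OF _ s])
  have "dseries chi holomorphic_on {s. 0 < Re s}"
    by (rule dseries_bounded_partial_sums(1)[OF dirichlet_char_partial_sums[OF chi np]])
  moreover have "(\<lambda>n. chi (Suc n) / of_nat (Suc n) powr s) sums dseries chi s" if "1 < Re s" for s
    by (rule dseries_sums[OF cmult_bounded_dsummable[OF dirichlet_char_cmult_bounded[OF chi]] that])
  ultimately show "continues_L q chi 0 (dseries chi)"
    using np unfolding continues_L_def by auto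
qed (use np in simp)

lemma dirichlet_L_trivial:
  assumes s: "0 < Re s" "s \<noteq> 1"
  shows "dirichlet_L 1 (\<lambda>_. 1) s = zeta_reg s / (s - 1)"
proof (rule dirichlet_L_eqI[OF _ s(1)])
  have p: "principal_char 1 (\<lambda>_. 1)" using dirichlet_char_trivial by (simp add: principal_char_def)
  have "(\<lambda>s. zeta_reg s / (s - 1)) holomorphic_on {s. 0 < Re s} - {1}"
    by (intro holomorphic_intros holomorphic_on_subset[OF zeta_reg_series(1)]) auto
  moreover have "(\<lambda>n. 1 / of_nat (Suc n) powr s) sums (zeta_reg s / (s - 1))" if s: "1 < Re s" for s
  proof -
    have "s \<noteq> 1" using s by auto
    then have "zeta_reg s / (s - 1) = dseries (\<lambda>_. 1) s" using zeta_reg_eq[OF s] by simp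
    then show ?thesis
      using dseries_sums[OF cmult_bounded_dsummable[OF dirichlet_char_cmult_bounded[OF dirichlet_char_trivial]] s] by simp
  qed
  ultimately show "continues_L 1 (\<lambda>_. 1) 0 (\<lambda>s. zeta_reg s / (s - 1))"
    using p unfolding continues_L_def by auto
qed (use s in simp)

lemma dseries_remove_primes:
  assumes c: "cmult_bounded c" and P: "finite P" "\<And>p. p \<in> P \<Longrightarrow> prime p" and s: "1 < Re s"
  shows "dseries (\<lambda>n. if \<exists>p\<in>P. p dvd n then 0 else c n) s = (\<Prod>p\<in>P. 1 - c p / of_nat p powr s) * dseries c s"
  using P
proof (induction P rule: finite_induct)
  case (insert r P)
  define b where "b = (\<lambda>n. if \<exists>p\<in>P. p dvd n then 0 else c n)"
  have b: "cmult_bounded b"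
    unfolding cmult_bounded_def
  proof (intro conjI allI)
    have "\<not> p dvd 1" if "p \<in> P" for p using insert.prems[of p] that not_prime_unit[of p] by auto
    then show "b 1 = 1" using c by (auto simp: b_def cmult_bounded_def)
    show "b (m * n) = b m * b n" for m n
    proof -
      have "(\<exists>p\<in>P. p dvd m * n) \<longleftrightarrow> (\<exists>p\<in>P. p dvd m) \<or> (\<exists>p\<in>P. p dvd n)"
        using insert.prems by (auto simp: prime_dvd_mult_iff)
      then show ?thesis using c by (auto simp: b_def cmult_bounded_def)
    qed
    show "norm (b n) \<le> 1" for n using c by (simp add: b_def cmult_bounded_def)
  qed
  have "\<not> p dvd r" if "p \<in> P" for p
    using primes_dvd_imp_eq[of p r] insert.hyps(2) insert.prems that by auto
  then have br: "b r = c r" by (auto simp: b_def)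
  have "(\<lambda>n. if \<exists>p\<in>insert r P. p dvd n then 0 else c n) = (\<lambda>n. if r dvd n then 0 else b n)"
    by (auto simp: b_def)
  then have "dseries (\<lambda>n. if \<exists>p\<in>insert r P. p dvd n then 0 else c n) s = (1 - b r / of_nat r powr s) * dseries b s"
    using dseries_remove_prime[OF b _ s, of r] insert.prems by simp
  also have "\<dots> = (\<Prod>p\<in>insert r P. 1 - c p / of_nat p powr s) * dseries c s"
    using insert.IH insert.hyps insert.prems br by (simp add: b_def)
  finally show ?case .
qed simp

text \<open>
  The two series differ by the Euler factors \<open>1 - psi p / p powr s\<close> at the primes dividing \<open>q\<close>. The
  relation is clear for \<open>Re s > 1\<close> and persists by continuation; the factors do not vanish for
  \<open>Re s > 0\<close> because \<open>|psi p / p powr s| < 1\<close> there.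
\<close>
lemma induced_zero:
  assumes ind: "induced_by q chi d psi" and chi: "dirichlet_char q chi"
    and np: "\<not> principal_char q chi" "\<not> principal_char d psi"
    and s: "0 < Re s" and zero: "dseries chi s = 0"
  shows "dseries psi s = 0"
proof -
  have psi: "dirichlet_char d psi" using ind by (simp add: induced_by_def)
  have cm: "cmult_bounded psi" by (rule dirichlet_char_cmult_bounded[OF psi])
  have q: "0 < q" using chi by (simp add: dirichlet_char_def)
  let ?E = "\<lambda>s. \<Prod>p\<in>prime_factors q. 1 - psi p / of_nat p powr s"
  have chi_eq: "chi = (\<lambda>n. if \<exists>p\<in>prime_factors q. p dvd n then 0 else psi n)"
  proof
    fix n
    have "coprime n q \<longleftrightarrow> \<not> (\<exists>p\<in>prime_factors q. p dvd n)"
    proof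
      show "\<not> (\<exists>p\<in>prime_factors q. p dvd n)" if "coprime n q"
      proof
        assume "\<exists>p\<in>prime_factors q. p dvd n"
        then obtain p where "prime p" "p dvd q" "p dvd n" by (auto simp: in_prime_factors_iff)
        then show False using coprime_common_divisor[OF that, of p] not_prime_unit by blast
      qed
      show "coprime n q" if "\<not> (\<exists>p\<in>prime_factors q. p dvd n)"
      proof (rule ccontr)
        assume "\<not> coprime n q"
        then have "gcd n q \<noteq> 1" by (simp only: coprime_iff_gcd_eq_1 not_False_eq_True)
        then obtain p where "prime p" "p dvd gcd n q" using prime_factor_nat by blast
        then have "prime p" "p dvd n" "p dvd q" by (simp_all only: gcd_greatest_iff)
        then show False using that q by (auto simp: prime_factors_dvd)
      qed
    qed
    then show "chi n = (if \<exists>p\<in>prime_factors q. p dvd n then 0 else psi n)"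
      using ind chi by (auto simp: induced_by_def dirichlet_char_def)
  qed
  have pp: "prime p" "0 < p" if "p \<in> prime_factors q" for p
    using that by (auto simp: in_prime_factors_iff prime_gt_0_nat)
  have "dseries chi s = ?E s * dseries psi s"
  proof (rule analytic_continuation_open[where s = "{s. 1 < Re s}" and s' = "{s. 0 < Re s}"
        and f = "dseries chi" and g = "\<lambda>s. ?E s * dseries psi s"])
    have "(2::complex) \<in> {s. 1 < Re s}" by simp
    then show "{s. 1 < Re s} \<noteq> {}" by blast
    show "connected {s. 0 < Re s}" by (intro convex_connected convex_halfspace_Re_gt)
    show "dseries chi holomorphic_on {s. 0 < Re s}"
      by (rule dseries_bounded_partial_sums(1)[OF dirichlet_char_partial_sums[OF chi np(1)]])
    have "dseries psi holomorphic_on {s. 0 < Re s}"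
      by (rule dseries_bounded_partial_sums(1)[OF dirichlet_char_partial_sums[OF psi np(2)]])
    then show "(\<lambda>s. ?E s * dseries psi s) holomorphic_on {s. 0 < Re s}"
      by (intro holomorphic_intros) (auto simp: complex_nonpos_Reals_iff intro: pp(2))
    show "dseries chi s = ?E s * dseries psi s" if "s \<in> {s. 1 < Re s}" for s
    proof -
      have "dseries (\<lambda>n. if \<exists>p\<in>prime_factors q. p dvd n then 0 else psi n) s = ?E s * dseries psi s"
        by (rule dseries_remove_primes[OF cm]) (use that pp in auto)
      then show ?thesis unfolding chi_eq[symmetric] .
    qed
  qed (use s open_halfplane in auto)
  moreover have "?E s \<noteq> 0"
  proof -
    have "psi p / of_nat p powr s \<noteq> 1" if p: "p \<in> prime_factors q" for p
    proof -
      have "1 < real p" using pp[OF p] prime_gt_1_nat by simp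
      then have "1 < real p powr Re s" using s by (rule gr_one_powr)
      moreover have "norm (of_nat p powr s :: complex) = real p powr Re s"
        by (subst norm_powr_real_powr) auto
      moreover have "norm (psi p) \<le> 1" using cm by (simp add: cmult_bounded_def)
      ultimately have "norm (psi p / of_nat p powr s) < 1"
        unfolding norm_divide by (simp add: divide_simps)
      then show ?thesis by (metis norm_one less_irrefl)
    qed
    then show ?thesis by (auto simp: prod_zero_iff)
  qed
  ultimately show ?thesis using zero by simp
qed

section \<open>Positivity\<close>

lemma dsummable_ln_power:
  assumes "dsummable a"
  shows "dsummable (\<lambda>n. a n * of_real (ln (real n) ^ j))"
proof (induction j)
  case (Suc j)
  have "(\<lambda>n. a n * of_real (ln (real n) ^ Suc j)) = (\<lambda>n. a n * of_real (ln (real n) ^ j) * of_real (ln (real n)))"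
    by (rule ext) (simp add: mult_ac)
  then show ?case using dsummable_ln[OF Suc] by simp
qed (use assms in simp)

text \<open>
  When \<open>chi1\<close> and \<open>chi2\<close> are distinct primitive quadratic characters, this is, up to finitely many Euler factors, the
  Dedekind zeta function of the biquadratic field that they define.
\<close>
definition biquadratic :: "(nat \<Rightarrow> complex) \<Rightarrow> (nat \<Rightarrow> complex) \<Rightarrow> complex \<Rightarrow> complex" where
  "biquadratic chi1 chi2 s = dseries (\<lambda>_. 1) s * dseries chi1 s * dseries chi2 s * dseries (\<lambda>n. chi1 n * chi2 n) s"

lemma cmult_bounded_one: "cmult_bounded (\<lambda>_. 1)"
  by (simp add: cmult_bounded_def)

lemma cmult_bounded_mult:
  assumes "cmult_bounded chi1" "cmult_bounded chi2"
  shows "cmult_bounded (\<lambda>n. chi1 n * chi2 n)"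
  using assms by (auto simp: cmult_bounded_def norm_mult intro: mult_le_one)

lemma biquadratic_holomorphic:
  assumes "cmult_bounded chi1" "cmult_bounded chi2"
  shows "biquadratic chi1 chi2 holomorphic_on {s. 1 < Re s}"
  unfolding biquadratic_def
  by (intro holomorphic_intros dseries_holomorphic cmult_bounded_dsummable cmult_bounded_one cmult_bounded_mult assms)

lemma biquadratic_nonzero:
  assumes "cmult_bounded chi1" "cmult_bounded chi2" "1 < Re s"
  shows "biquadratic chi1 chi2 s \<noteq> 0"
  unfolding biquadratic_def
  using assms by (simp add: dseries_nonzero cmult_bounded_one cmult_bounded_mult)

lemma log_deriv_coeff_biquadratic:
  assumes c: "cmult_bounded chi1" "cmult_bounded chi2" and s: "1 < Re s"
  shows "log_deriv_coeff j (biquadratic chi1 chi2) s =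
    log_deriv_coeff j (dseries (\<lambda>_. 1)) s + log_deriv_coeff j (dseries chi1) s +
    log_deriv_coeff j (dseries chi2) s + log_deriv_coeff j (dseries (\<lambda>n. chi1 n * chi2 n)) s"
proof -
  let ?S = "{s. 1 < Re s}"
  have h: "dseries chi holomorphic_on ?S" if "cmult_bounded chi" for chi
    by (intro dseries_holomorphic cmult_bounded_dsummable that)
  note hs = h[OF cmult_bounded_one] h[OF c(1)] h[OF c(2)] h[OF cmult_bounded_mult[OF c]]
  note nz = dseries_nonzero[OF cmult_bounded_one s] dseries_nonzero[OF c(1) s]
    dseries_nonzero[OF c(2) s] dseries_nonzero[OF cmult_bounded_mult[OF c] s]
  have m: "log_deriv_coeff j (\<lambda>w. f w * g w) s = log_deriv_coeff j f s + log_deriv_coeff j g s"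
    if "f holomorphic_on ?S" "g holomorphic_on ?S" "f s \<noteq> 0" "g s \<noteq> 0" for f g
    by (rule log_deriv_coeff_mult[OF that(1,2) open_halfplane _ that(3,4)]) (use s in simp)
  have eq: "biquadratic chi1 chi2 = (\<lambda>w. ((dseries (\<lambda>_. 1) w * dseries chi1 w) * dseries chi2 w) * dseries (\<lambda>n. chi1 n * chi2 n) w)"
    by (rule ext) (simp only: biquadratic_def)
  show ?thesis
    unfolding eq
    by (subst m, intro holomorphic_on_mult hs, rule hs, use nz in simp, rule nz,
        subst m, intro holomorphic_on_mult hs, rule hs, use nz in simp, rule nz,
        subst m, rule hs, rule hs, rule nz, rule nz, rule refl)
qed

text \<open>
  The four von Mangoldt series add up to one with the coefficients
  \<open>\<Lambda>(n) (1 + chi1 n) (1 + chi2 n) (ln n)^j\<close>, and these are nonnegative for real characters with values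
  in \<open>[-1, 1]\<close>.
\<close>
lemma log_deriv_coeff_biquadratic_nonpos:
  assumes c: "cmult_bounded chi1" "cmult_bounded chi2" and real: "\<And>n. chi1 n \<in> \<real>" "\<And>n. chi2 n \<in> \<real>"
    and t: "1 < t"
  shows "Re (log_deriv_coeff j (biquadratic chi1 chi2) (of_real t)) \<le> 0"
proof -
  let ?s = "complex_of_real t"
  define b where "b = (\<lambda>chi n. chi n * mangoldt n * complex_of_real (ln (real n) ^ j))"
  define T where "T = (\<lambda>chi n. b chi (Suc n) / of_nat (Suc n) powr ?s)"
  have t': "1 < Re ?s" using t by simp
  have sums: "T chi sums dseries (b chi) ?s" if "cmult_bounded chi" for chi
    unfolding T_def b_def by (rule dseries_sums[OF dsummable_ln_power[OF dsummable_mangoldt[OF that]] t'])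
  let ?D = "dseries (b (\<lambda>_. 1)) ?s + dseries (b chi1) ?s + dseries (b chi2) ?s + dseries (b (\<lambda>n. chi1 n * chi2 n)) ?s"
  have S: "(\<lambda>n. T (\<lambda>_. 1) n + T chi1 n + T chi2 n + T (\<lambda>n. chi1 n * chi2 n) n) sums ?D"
    by (intro sums_add sums c cmult_bounded_one cmult_bounded_mult)
  have nonneg: "0 \<le> Re (T (\<lambda>_. 1) n + T chi1 n + T chi2 n + T (\<lambda>n. chi1 n * chi2 n) n)" for n
  proof -
    obtain x where x: "chi1 (Suc n) = of_real x" using real by (meson Reals_cases)
    obtain y where y: "chi2 (Suc n) = of_real y" using real by (meson Reals_cases)
    have "norm (chi1 (Suc n)) \<le> 1" "norm (chi2 (Suc n)) \<le> 1" using c by (simp_all add: cmult_bounded_def)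
    then have xy: "0 \<le> 1 + x" "0 \<le> 1 + y" using x y by auto
    define w where "w = mangoldt (Suc n) * ln (real (Suc n)) ^ j / real (Suc n) powr t"
    have "0 \<le> w" unfolding w_def
      by (intro divide_nonneg_nonneg mult_nonneg_nonneg mangoldt_nonneg zero_le_power ln_ge_zero) auto
    have p: "(of_nat (Suc n) :: complex) powr ?s = of_real (real (Suc n) powr t)"
      using powr_of_real[of "real (Suc n)" t] by simp
    have m: "mangoldt (Suc n) = complex_of_real (mangoldt (Suc n))" by simp
    have Tc: "T chi n = chi (Suc n) * of_real w" for chi
      unfolding T_def b_def p w_def m by (simp del: of_real_mangoldt of_nat_Suc)
    have "T (\<lambda>_. 1) n + T chi1 n + T chi2 n + T (\<lambda>n. chi1 n * chi2 n) n = of_real ((1 + x) * (1 + y) * w)"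
      unfolding Tc x y by (simp add: algebra_simps)
    then show ?thesis using \<open>0 \<le> w\<close> xy by simp
  qed
  have "0 \<le> Re ?D"
    by (rule sums_le[where f = "\<lambda>_. 0", OF nonneg sums_zero sums_Re[OF S]])
  moreover have "log_deriv_coeff j (biquadratic chi1 chi2) ?s = - ?D / fact j"
    unfolding log_deriv_coeff_biquadratic[OF c t'] b_def
    by (simp only: log_deriv_coeff_dseries[OF cmult_bounded_one t'] log_deriv_coeff_dseries[OF c(1) t']
        log_deriv_coeff_dseries[OF c(2) t'] log_deriv_coeff_dseries[OF cmult_bounded_mult[OF c] t'])
       (simp add: add_divide_distrib diff_divide_distrib)
  moreover have "Re (- z / fact j) = - Re z / fact j" for z
    using Re_divide_of_real[of "- z" "fact j"] by simp
  ultimately show ?thesis by (simp only: divide_nonpos_pos[OF _ fact_gt_zero] neg_le_0_iff_le)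
qed

text \<open>
  The real part of \<open>f'/f\<close> is the derivative of \<open>ln |f|\<close> along the real axis.
\<close>
lemma norm_nonincreasing_on_real_axis:
  assumes f: "f holomorphic_on {s. 1 < Re s}" and nz: "\<And>s. 1 < Re s \<Longrightarrow> f s \<noteq> 0"
    and neg: "\<And>t. 1 < t \<Longrightarrow> Re (deriv f (of_real t) / f (of_real t)) \<le> 0"
    and ab: "1 < a" "a \<le> b"
  shows "norm (f (of_real b)) \<le> norm (f (of_real a))"
proof -
  let ?S = "{s. 1 < Re s}"
  obtain h where h: "h holomorphic_on ?S" "\<And>w. w \<in> ?S \<Longrightarrow> exp (h w) = f w"
    using holomorphic_logarithm_exists[OF convex_halfspace_Re_gt open_halfplane f, of "of_real a"] nz ab by auto
  have "Re (h (of_real b)) \<le> Re (h (of_real a))"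
  proof (rule DERIV_nonpos_imp_nonincreasing[OF ab(2)])
    fix t assume "a \<le> t" "t \<le> b"
    then have t: "1 < t" using ab by simp
    have D: "(h has_field_derivative deriv h (of_real t)) (at (of_real t))"
      by (rule holomorphic_derivI[OF h(1) open_halfplane]) (use t in simp)
    have "((\<lambda>w. exp (h w)) has_field_derivative exp (h (of_real t)) * deriv h (of_real t)) (at (of_real t))"
      by (rule DERIV_chain2[OF DERIV_exp D])
    then have "(f has_field_derivative exp (h (of_real t)) * deriv h (of_real t)) (at (of_real t))"
      by (rule has_field_derivative_transform_within_open[OF _ open_halfplane[of 1]]) (use h t in auto)
    then have "deriv f (of_real t) / f (of_real t) = deriv h (of_real t)"
      using h(2)[of "of_real t"] nz[of "of_real t"] t by (simp add: DERIV_imp_deriv)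
    then have le: "Re (deriv h (of_real t)) \<le> 0" using neg[OF t] by simp
    have "((\<lambda>x. Re (h (of_real x))) has_vector_derivative Re (deriv h (of_real t))) (at t)"
      by (rule bounded_linear.has_vector_derivative[OF bounded_linear_Re has_vector_derivative_real_field[OF D]])
    then have "((\<lambda>x. Re (h (of_real x))) has_field_derivative Re (deriv h (of_real t))) (at t)"
      by (simp only: has_real_derivative_iff_has_vector_derivative)
    then show "\<exists>y. ((\<lambda>x. Re (h (of_real x))) has_field_derivative y) (at t) \<and> y \<le> 0" using le by blast
  qed
  then have "exp (Re (h (of_real b))) \<le> exp (Re (h (of_real a)))" by simp
  then show ?thesis using h(2)[of "of_real a"] h(2)[of "of_real b"] ab by (simp flip: norm_exp_eq_Re)
qed

text \<open>
  The modulus decreases from \<open>t\<close> to 4, where each of the four factors is at least \<open>1/2\<close>.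
\<close>
lemma biquadratic_lower_bound:
  assumes c: "cmult_bounded chi1" "cmult_bounded chi2" and real: "\<And>n. chi1 n \<in> \<real>" "\<And>n. chi2 n \<in> \<real>"
    and t: "1 < t" "t \<le> 4"
  shows "1 / 16 \<le> norm (biquadratic chi1 chi2 (of_real t))"
proof -
  have "norm (biquadratic chi1 chi2 (of_real 4)) \<le> norm (biquadratic chi1 chi2 (of_real t))"
  proof (rule norm_nonincreasing_on_real_axis[OF biquadratic_holomorphic[OF c] biquadratic_nonzero[OF c] _ t])
    show "Re (deriv (biquadratic chi1 chi2) (of_real t) / biquadratic chi1 chi2 (of_real t)) \<le> 0" if "1 < t" for t
      using log_deriv_coeff_biquadratic_nonpos[OF c real that, of 0] by (simp add: log_deriv_coeff_def)
  qed auto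
  moreover have "1 / 2 * (1 / 2) * (1 / 2) * (1 / 2) \<le> norm (biquadratic chi1 chi2 4)"
    unfolding biquadratic_def norm_mult
    by (intro mult_mono dseries_at_4 c cmult_bounded_one cmult_bounded_mult mult_nonneg_nonneg norm_ge_zero) auto
  ultimately show ?thesis by simp
qed

section \<open>Two zeros near 1\<close>

text \<open>
  The positivity of the von Mangoldt coefficients bounds the logarithmic derivative of
  \<open>(s - 1) \<zeta>(s) L(s,chi1) L(s,chi2) L(s,chi1 chi2)\<close> from above, the two zeros bound it from below.
  The zeros are split off from their own factors \<open>L(s,chi1)\<close> and \<open>L(s,chi2)\<close>, so
  \<open>beta1 = beta2\<close> simply gives a double zero of the product.
\<close>
lemma two_zeros_inequality:
  fixes beta1 beta2 eta delta r Z B1 B2 B3 :: real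
  assumes c: "cmult_bounded chi1" "cmult_bounded chi2" and real: "\<And>n. chi1 n \<in> \<real>" "\<And>n. chi2 n \<in> \<real>"
    and hol: "dseries chi1 holomorphic_on {s. 0 < Re s}" "dseries chi2 holomorphic_on {s. 0 < Re s}"
      "dseries (\<lambda>n. chi1 n * chi2 n) holomorphic_on {s. 0 < Re s}"
    and bound: "\<And>s. s \<in> cball 1 (3/4) \<Longrightarrow> norm (zeta_reg s) \<le> Z"
      "\<And>s. s \<in> cball 1 (3/4) \<Longrightarrow> norm (dseries chi1 s) \<le> B1"
      "\<And>s. s \<in> cball 1 (3/4) \<Longrightarrow> norm (dseries chi2 s) \<le> B2"
      "\<And>s. s \<in> cball 1 (3/4) \<Longrightarrow> norm (dseries (\<lambda>n. chi1 n * chi2 n) s) \<le> B3"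
    and beta: "dseries chi1 (of_real beta1) = 0" "dseries chi2 (of_real beta2) = 0"
      "1 - delta \<le> beta1" "beta1 < 1" "1 - delta \<le> beta2" "beta2 < 1"
    and par: "0 < eta" "eta \<le> 1 / 8" "delta \<le> 1 / 8" "0 < r" "r \<le> 1 / 6"
    and zeros: "\<And>s. s \<in> ball (1 + of_real eta) r \<Longrightarrow>
      zeta_reg s = 0 \<or> dseries chi1 s = 0 \<or> dseries chi2 s = 0 \<or> dseries (\<lambda>n. chi1 n * chi2 n) s = 0 \<Longrightarrow> s \<in> \<real>"
  shows "2 / (eta + delta) ^ Suc j
           \<le> 1 / eta ^ Suc j + 2 * real (Suc j) * (2 / r) ^ Suc j * ln (16 * (Z * B1 * B2 * B3) / eta)"
proof -
  let ?S = "{s. 0 < Re s}"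
  let ?L12 = "dseries (\<lambda>n. chi1 n * chi2 n)"
  define s0 where "s0 = 1 + eta"
  let ?s = "complex_of_real s0"
  have s1: "1 < s0" using par by (simp add: s0_def)
  have S: "open ?S" "?s \<in> ?S" using s1 open_halfplane by auto
  define G where "G = (\<lambda>s. zeta_reg s * dseries chi1 s * dseries chi2 s * ?L12 s)"
  define M where "M = Z * B1 * B2 * B3"
  have Ghol: "G holomorphic_on ?S"
    unfolding G_def by (intro holomorphic_intros hol zeta_reg_series(1))
  have GF: "G s = (s - 1) * biquadratic chi1 chi2 s" if "1 < Re s" for s
    unfolding G_def biquadratic_def zeta_reg_eq[OF that] by (simp only: mult.assoc)
  have Gnz: "G s \<noteq> 0" if "1 < Re s" for s
    using GF[OF that] biquadratic_nonzero[OF c that] that by auto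
  have Glow: "eta / 16 \<le> norm (G ?s)"
  proof -
    have "1 / 16 \<le> norm (biquadratic chi1 chi2 ?s)"
      by (rule biquadratic_lower_bound[OF c real s1]) (use par in \<open>simp add: s0_def\<close>)
    then have "eta * (1 / 16) \<le> eta * norm (biquadratic chi1 chi2 ?s)"
      using par by (intro mult_left_mono) auto
    also have "\<dots> = norm (G ?s)"
      using s1 par GF[of ?s] by (simp add: norm_mult s0_def)
    finally show ?thesis by simp
  qed
  have Gup: "norm (G s) \<le> M" if s: "s \<in> cball 1 (3/4)" for s
    unfolding G_def M_def norm_mult
    by (intro mult_mono bound s mult_nonneg_nonneg norm_ge_zero order_trans[OF norm_ge_zero bound(1)[OF s]]
        order_trans[OF norm_ge_zero bound(2)[OF s]] order_trans[OF norm_ge_zero bound(3)[OF s]])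
  \<comment> \<open>Only the simple zero of \<open>s - 1\<close>, that is, the pole of the zeta function, contributes positively.\<close>
  have up: "Re (log_deriv_coeff j G ?s) \<le> 1 / eta ^ Suc j"
  proof -
    have "log_deriv_coeff j G ?s = log_deriv_coeff j (\<lambda>s. (s - 1) * biquadratic chi1 chi2 s) ?s"
      by (rule log_deriv_coeff_cong[OF holomorphic_on_subset[OF Ghol] open_halfplane[of 1]])
         (use s1 Gnz GF in auto)
    also have "\<dots> = log_deriv_coeff j (\<lambda>s. s - 1) ?s + log_deriv_coeff j (biquadratic chi1 chi2) ?s"
      by (rule log_deriv_coeff_mult[OF _ biquadratic_holomorphic[OF c] open_halfplane])
         (use s1 biquadratic_nonzero[OF c] in \<open>auto intro!: holomorphic_intros\<close>)
    also have "log_deriv_coeff j (\<lambda>s. s - 1) ?s = of_real (1 / eta ^ Suc j)"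
      by (subst log_deriv_coeff_linear) (use par in \<open>auto simp: s0_def\<close>)
    finally show ?thesis
      using log_deriv_coeff_biquadratic_nonpos[OF c real s1, of j] by (simp del: of_real_divide of_real_power power_Suc)
  qed
  \<comment> \<open>Dividing out the zeros with the normalisation \<open>(s0 - beta) / (s - beta)\<close> keeps the value at \<open>s0\<close> and
    does not enlarge the bound on the circle of radius \<open>1/2\<close>.\<close>
  obtain g1 where g1: "g1 holomorphic_on ?S" "\<And>w. w \<in> ?S \<Longrightarrow> dseries chi1 w = (w - of_real beta1) * g1 w"
    using factor_zero[OF hol(1) S(1) beta(1)] by blast
  obtain g2 where g2: "g2 holomorphic_on ?S" "\<And>w. w \<in> ?S \<Longrightarrow> dseries chi2 w = (w - of_real beta2) * g2 w"
    using factor_zero[OF hol(2) S(1) beta(2)] by blast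
  define K where "K = (\<lambda>s. of_real ((s0 - beta1) * (s0 - beta2)) * (zeta_reg s * g1 s * g2 s * ?L12 s))"
  define P where "P = (\<lambda>s :: complex. (s - of_real beta1) * (s - of_real beta2))"
  have Khol: "K holomorphic_on ?S"
    unfolding K_def by (intro holomorphic_intros hol zeta_reg_series(1) g1 g2)
  have GK: "of_real ((s0 - beta1) * (s0 - beta2)) * G s = P s * K s" if "s \<in> ?S" for s
    unfolding G_def K_def P_def g1(2)[OF that] g2(2)[OF that] by (simp only: mult_ac)
  have sb: "0 < s0 - beta1" "0 < s0 - beta2" "s0 - beta1 \<le> eta + delta" "s0 - beta2 \<le> eta + delta"
    using beta s1 by (auto simp: s0_def)
  have Ps: "P ?s = of_real ((s0 - beta1) * (s0 - beta2))" by (simp add: P_def)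
  have cnz: "complex_of_real ((s0 - beta1) * (s0 - beta2)) \<noteq> 0" using sb by simp
  have KG: "K ?s = G ?s" using GK[OF S(2)] cnz unfolding Ps by (auto simp only: mult_cancel_left)
  have G0: "G ?s \<noteq> 0" by (rule Gnz) (use s1 in simp)
  have low: "- (2 * real (Suc j) * (2 / r) ^ Suc j * ln (M / norm (K ?s))) \<le> Re (log_deriv_coeff j K ?s)"
  proof (rule log_deriv_coeff_lower_bound[OF par(4) _ S(1) _ Khol])
    show "3 * r \<le> 1 / 2" using par by simp
    have dist: "\<bar>Re w - s0\<bar> \<le> norm (w - ?s)" for w using abs_Re_le_cmod[of "w - ?s"] by simp
    show "cball ?s (1 / 2) \<subseteq> ?S"
    proof
      fix w assume "w \<in> cball ?s (1 / 2)"
      then have "norm (w - ?s) \<le> 1 / 2" by (simp add: dist_norm norm_minus_commute)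
      then show "w \<in> ?S" using dist[of w] s1 by simp
    qed
    show "K ?s \<noteq> 0" using KG G0 by simp
    show "norm (K w) \<le> M" if w: "norm (w - ?s) = 1 / 2" for w
    proof -
      have "0 < Re w" using dist[of w] s1 w by linarith
      then have wS: "w \<in> ?S" by simp
      have far: "s0 - b \<le> norm (w - of_real b)" if b: "0 < s0 - b" "s0 - b \<le> eta + delta" for b
      proof -
        have "1 / 2 \<le> norm (w - of_real b) + norm (of_real b - ?s)"
          using norm_triangle_ineq[of "w - of_real b" "of_real b - ?s"] w by simp
        moreover have "norm (of_real b - ?s) = s0 - b" using b by (simp flip: of_real_diff)
        ultimately show ?thesis using b par by simp
      qed
      have "norm (1 - w) \<le> norm (w - ?s) + norm (?s - 1)"
        using norm_triangle_ineq[of "w - ?s" "?s - 1"] by (simp add: norm_minus_commute)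
      also have "norm (?s - 1) = eta" using par by (simp add: s0_def)
      finally have "w \<in> cball 1 (3/4)" using w par by (simp add: dist_norm)
      then have GM: "norm (G w) \<le> M" by (rule Gup)
      have "(s0 - beta1) * (s0 - beta2) * norm (K w) \<le> norm (P w) * norm (K w)"
        unfolding P_def norm_mult
        using far[of beta1] far[of beta2] sb by (intro mult_right_mono mult_mono) auto
      also have "\<dots> = (s0 - beta1) * (s0 - beta2) * norm (G w)"
        using arg_cong[OF GK[OF wS], of norm] sb by (simp add: norm_mult del: of_real_mult of_real_diff)
      finally have "norm (K w) \<le> norm (G w)" using sb by simp
      then show ?thesis using GM by simp
    qed
    show "w \<in> \<real> \<and> Re w < s0" if w: "w \<in> ball ?s r" "K w = 0" for w
    proof -
      have "norm (w - ?s) < r" using w(1) by (simp add: dist_norm norm_minus_commute)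
      then have wS: "w \<in> ?S" using dist[of w] s1 par by simp
      have "G w = 0" using GK[OF wS] w(2) cnz by simp
      then have "zeta_reg w = 0 \<or> dseries chi1 w = 0 \<or> dseries chi2 w = 0 \<or> ?L12 w = 0"
        by (simp add: G_def)
      then have "w \<in> \<real>" using zeros[of w] w(1) by (simp add: s0_def)
      moreover have "\<not> 1 < Re w" using Gnz \<open>G w = 0\<close> by blast
      ultimately show ?thesis using s1 by simp
    qed
  qed
  have split: "log_deriv_coeff j G ?s = of_real (1 / (s0 - beta1) ^ Suc j + 1 / (s0 - beta2) ^ Suc j) + log_deriv_coeff j K ?s"
  proof -
    have bne: "?s \<noteq> of_real beta1" "?s \<noteq> of_real beta2" using sb by auto
    have Kne: "K ?s \<noteq> 0" using KG G0 by simp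
    have "log_deriv_coeff j G ?s = log_deriv_coeff j (\<lambda>s. of_real ((s0 - beta1) * (s0 - beta2)) * G s) ?s"
      by (subst log_deriv_coeff_mult[OF holomorphic_on_const Ghol S cnz G0]) simp
    also have "\<dots> = log_deriv_coeff j (\<lambda>s. P s * K s) ?s"
      by (rule log_deriv_coeff_cong[OF _ S]) (use GK cnz G0 in \<open>auto intro!: holomorphic_intros Ghol\<close>)
    also have "\<dots> = log_deriv_coeff j P ?s + log_deriv_coeff j K ?s"
      by (rule log_deriv_coeff_mult[OF _ Khol S _ Kne])
         (use bne in \<open>auto simp: P_def intro!: holomorphic_intros\<close>)
    also have "log_deriv_coeff j P ?s = log_deriv_coeff j (\<lambda>s. s - of_real beta1) ?s + log_deriv_coeff j (\<lambda>s. s - of_real beta2) ?s"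
      unfolding P_def
      by (rule log_deriv_coeff_mult[OF _ _ S]) (use bne in \<open>auto intro!: holomorphic_intros\<close>)
    also have "\<dots> = of_real (1 / (s0 - beta1) ^ Suc j + 1 / (s0 - beta2) ^ Suc j)"
      unfolding log_deriv_coeff_linear[OF bne(1)] log_deriv_coeff_linear[OF bne(2)]
      by (simp del: power_Suc)
    finally show ?thesis .
  qed
  have each: "1 / (eta + delta) ^ Suc j \<le> 1 / (s0 - b) ^ Suc j" if "0 < s0 - b" "s0 - b \<le> eta + delta" for b
    using that by (intro divide_left_mono power_mono mult_pos_pos zero_less_power) auto
  have lnle: "ln (M / norm (K ?s)) \<le> ln (16 * M / eta)"
  proof -
    have "norm (G ?s) \<le> M"
      by (rule Gup) (use par in \<open>simp add: s0_def dist_norm\<close>)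
    then have Mpos: "0 < M" using G0 by (meson less_le_trans zero_less_norm_iff)
    have "M / norm (G ?s) \<le> M / (eta / 16)"
      using Mpos Glow par by (intro divide_left_mono) (auto intro: mult_pos_pos simp: G0)
    then show ?thesis unfolding KG using Mpos G0 by (subst ln_le_cancel_iff) (use par in \<open>auto simp: mult.commute\<close>)
  qed
  have "2 * real (Suc j) * (2 / r) ^ Suc j * ln (M / norm (K ?s)) \<le> 2 * real (Suc j) * (2 / r) ^ Suc j * ln (16 * M / eta)"
    using par by (intro mult_left_mono lnle) auto
  moreover have "Re (log_deriv_coeff j G ?s) = 1 / (s0 - beta1) ^ Suc j + 1 / (s0 - beta2) ^ Suc j + Re (log_deriv_coeff j K ?s)"
    unfolding split by (simp only: plus_complex.simps Re_complex_of_real)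
  moreover have "2 / (eta + delta) ^ Suc j = 1 / (eta + delta) ^ Suc j + 1 / (eta + delta) ^ Suc j" by simp
  ultimately show ?thesis
    using low up each[OF sb(1,3)] each[OF sb(2,4)] unfolding M_def by linarith
qed

text \<open>
  This is the inequality of the previous lemma, negated, at \<open>\<eta> = 1/y\<^sup>2\<close>, \<open>\<delta> = 1/y^4\<close>, \<open>r = 1/(4y)\<close>
  and \<open>j = n\<close>. In units of \<open>\<eta>^(-(n+1))\<close>, Bernoulli's inequality gives \<open>2 (1 + 1/y\<^sup>2)^(-(n+1)) \<ge> 7/4\<close>,
  whereas the other side is at most \<open>1 + 1/4\<close>: the error term \<open>2 (n+1) (8y)^(n+1) C y^n\<close> amounts to
  \<open>2 (n+1) 8^(n+1) C / y\<close>.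
\<close>
lemma two_zeros_inequality_fails:
  fixes y C :: real
  assumes C: "1 \<le> C" and y: "8 * real (Suc n) * C * 8 ^ Suc n \<le> y" and A: "A \<le> C * y ^ n"
  shows "1 / (1 / y ^ 2) ^ Suc n + 2 * real (Suc n) * (2 / (1 / (4 * y))) ^ Suc n * A
           < 2 / (1 / y ^ 2 + 1 / y ^ 4) ^ Suc n"
proof -
  define J where "J = Suc n"
  define w where "w = 1 / y ^ 2"
  have j1: "1 \<le> real J" by (simp add: J_def)
  have p8: "1 \<le> (8::real) ^ J" by simp
  have CJ: "1 \<le> C * 8 ^ J" using mult_mono[OF C p8] C by simp
  have "8 * real J * 1 \<le> 8 * real J * (C * 8 ^ J)" using CJ by (intro mult_left_mono) auto
  moreover have yJ: "8 * real J * (C * 8 ^ J) \<le> y" using y unfolding J_def by (simp only: mult.assoc)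
  ultimately have y8J: "8 * real J \<le> y" by linarith
  then have y8: "8 \<le> y" using j1 by linarith
  have w: "0 < w" "w \<le> 1" using y8 by (auto simp: w_def field_simps intro: one_le_power)
  have wJ: "(y ^ 2) ^ J * w ^ J = 1" using y8 by (simp add: w_def power_divide)
  have "real J * w \<le> 1 / 8"
  proof -
    have "8 * real J * 1 \<le> y * y" using y8J y8 by (intro mult_mono) auto
    then show ?thesis using y8 by (simp add: w_def field_simps power2_eq_square)
  qed
  then have bern: "7 / 8 \<le> (1 - w) ^ J"
    using Bernoulli_inequality[of "- w" J] w by simp
  have low: "7 / 4 / w ^ J \<le> 2 / (w + w ^ 2) ^ J"
  proof -
    have "(1 - w) ^ J * (w + w ^ 2) ^ J = (w * (1 - w ^ 2)) ^ J"
      unfolding power_mult_distrib[symmetric] by (simp add: algebra_simps power2_eq_square)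
    also have "\<dots> \<le> w ^ J"
      using w by (intro power_mono) (auto simp: mult_le_cancel_left1 power_le_one intro!: mult_nonneg_nonneg)
    finally have "7 / 8 * (w + w ^ 2) ^ J \<le> w ^ J"
      using mult_right_mono[OF bern, of "(w + w ^ 2) ^ J"] w by simp
    moreover have "0 < (w + w ^ 2) ^ J" "0 < w ^ J" using w by (auto intro!: zero_less_power add_pos_pos)
    ultimately show ?thesis by (simp add: field_simps)
  qed
  have "2 * real J * (2 / (1 / (4 * y))) ^ J * A \<le> 2 * real J * (8 * y) ^ J * (C * y ^ n)"
    using A y8 by (simp add: J_def mult_left_mono)
  also have "\<dots> = 2 * real J * C * 8 ^ J * (y ^ J * y ^ n)"
    by (simp add: power_mult_distrib mult_ac)
  also have "\<dots> \<le> y / 4 * (y ^ J * y ^ n)"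
    using yJ y8 by (intro mult_right_mono) (auto simp: mult.assoc)
  also have "\<dots> = 1 / 4 * (y ^ 2) ^ J"
    by (simp add: J_def power_mult_distrib power2_eq_square mult_ac)
  also have "\<dots> = 1 / 4 / w ^ J" using wJ w by (simp add: field_simps)
  finally have "1 / w ^ J + 2 * real J * (2 / (1 / (4 * y))) ^ J * A \<le> 5 / 4 / w ^ J" by (simp add: field_simps)
  also have "\<dots> < 7 / 4 / w ^ J" using w by (simp add: divide_strict_right_mono)
  also note low
  finally show ?thesis
    by (simp add: J_def w_def power_divide flip: power_mult)
qed

text \<open>
  The left-hand side is at most \<open>2^((c + 23) k)\<close> when \<open>2^c\<close> exceeds \<open>C + D\<close>. Its power with exponent
  \<open>4k\<close> is therefore at most \<open>2^(4 (c + 23) k\<^sup>2)\<close>, and \<open>ln (2^(2^N)) \<ge> 2^(N - 1)\<close>.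
\<close>
lemma threshold_large:
  fixes C D :: real
  assumes "0 \<le> C" "0 \<le> D"
  obtains m :: nat where "\<And>k Q. 1 \<le> k \<Longrightarrow> 2 ^ 2 ^ (m * (k * k)) \<le> Q \<Longrightarrow>
      8 * real (Suc (4 * k)) * C * 8 ^ Suc (4 * k) + D \<le> ln Q powr (1 / real (4 * k)) \<and> 1 \<le> ln Q \<and> 1 \<le> Q"
proof -
  obtain c where c: "C + D < 2 ^ c" using real_arch_pow[of 2 "C + D"] by auto
  define m where "m = 4 * (c + 23) + 1"
  show ?thesis
  proof (rule that[of m])
    fix k :: nat and Q :: real
    assume k: "1 \<le> k" and Q: "2 ^ 2 ^ (m * (k * k)) \<le> Q"
    define Y where "Y = 8 * real (Suc (4 * k)) * C * 8 ^ Suc (4 * k) + D"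
    have Y0: "0 \<le> Y" using assms by (auto simp: Y_def intro!: add_nonneg_nonneg mult_nonneg_nonneg)
    have Q1: "1 \<le> Q" using Q by (rule order_trans[rotated]) simp
    have n1: "real (Suc (4 * k)) \<le> 2 ^ Suc (4 * k)"
      using of_nat_less_two_power[of "Suc (4 * k)", where 'a = real] by (rule less_imp_le)
    have e1: "(8::real) ^ Suc (4 * k) = 2 ^ (3 * Suc (4 * k))" by (simp only: power_mult) simp
    have one: "1 \<le> 8 * real (Suc (4 * k)) * 8 ^ Suc (4 * k)"
    proof -
      have "1 \<le> (8::real) ^ Suc (4 * k)" by (rule one_le_power) simp
      then have "1 * 1 \<le> 8 * real (Suc (4 * k)) * 8 ^ Suc (4 * k)" by (intro mult_mono) simp_all
      then show ?thesis by (simp only: mult_1)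
    qed
    have "Y \<le> 8 * real (Suc (4 * k)) * 8 ^ Suc (4 * k) * (C + D)"
      using mult_right_mono[OF one assms(2)] by (simp add: Y_def algebra_simps)
    also have "\<dots> \<le> 2 ^ 3 * 2 ^ Suc (4 * k) * 2 ^ (3 * Suc (4 * k)) * 2 ^ c"
      unfolding e1 using n1 c assms by (intro mult_mono) auto
    also have "\<dots> = 2 ^ (3 + Suc (4 * k) + 3 * Suc (4 * k) + c)" by (simp only: power_add)
    also have "\<dots> \<le> 2 ^ ((c + 23) * k)"
    proof (rule power_increasing)
      have "c * 1 \<le> c * k" using k by (intro mult_le_mono) auto
      moreover have "3 + Suc (4 * k) + 3 * Suc (4 * k) \<le> 23 * k" using k by simp
      ultimately show "3 + Suc (4 * k) + 3 * Suc (4 * k) + c \<le> (c + 23) * k"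
        unfolding add_mult_distrib by linarith
    qed simp
    finally have "Y ^ (4 * k) \<le> (2 ^ ((c + 23) * k)) ^ (4 * k)" using Y0 by (intro power_mono)
    also have "\<dots> = 2 ^ (4 * (c + 23) * (k * k))" by (simp add: mult_ac flip: power_mult)
    finally have Yk: "Y ^ (4 * k) \<le> 2 ^ (4 * (c + 23) * (k * k))" .
    have kk: "1 \<le> k * k" using k mult_le_mono[of 1 k 1 k] by simp
    have "(2::real) * 2 ^ (4 * (c + 23) * (k * k)) = 2 ^ (4 * (c + 23) * (k * k) + 1)" by simp
    also have "\<dots> \<le> 2 ^ (m * (k * k))"
      by (rule power_increasing) (use kk in \<open>auto simp: m_def add_mult_distrib\<close>)
    finally have pw: "(2::real) * 2 ^ (4 * (c + 23) * (k * k)) \<le> 2 ^ (m * (k * k))" .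
    have "2 ^ (m * (k * k)) * (1 / 2) \<le> 2 ^ (m * (k * k)) * ln (2::real)"
      using ln2_ge_two_thirds by (intro mult_left_mono) auto
    also have "\<dots> = ln ((2::real) ^ 2 ^ (m * (k * k)))" by (simp add: ln_realpow)
    also have "\<dots> \<le> ln Q" using Q Q1 by (subst ln_le_cancel_iff) auto
    finally have lnQ: "2 ^ (4 * (c + 23) * (k * k)) \<le> ln Q" using pw by simp
    have "(1::real) \<le> 2 ^ (4 * (c + 23) * (k * k))" by simp
    then have L1: "1 \<le> ln Q" using lnQ by linarith
    have "Y \<le> ln Q powr (1 / real (4 * k))"
    proof (cases "Y = 0")
      case False
      then have Ypos: "0 < Y" using Y0 by simp
      have "Y = (Y ^ (4 * k)) powr (1 / real (4 * k))"
        using Ypos k by (simp add: powr_realpow[symmetric] powr_powr)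
      also have "\<dots> \<le> ln Q powr (1 / real (4 * k))"
        using order_trans[OF Yk lnQ] Ypos by (intro powr_mono2) auto
      finally show ?thesis .
    qed simp
    then show "8 * real (Suc (4 * k)) * C * 8 ^ Suc (4 * k) + D \<le> ln Q powr (1 / real (4 * k)) \<and> 1 \<le> ln Q \<and> 1 \<le> Q"
      using L1 Q1 by (simp only: Y_def)
  qed
qed

text \<open>
  By continuity, since \<open>(s - 1) \<zeta>(s)\<close> is 1 at the point 1. This serves twice: it excludes the trivial
  character, and it takes the place of a hypothesis on the zeros of the zeta function.
\<close>
lemma zeta_reg_zero_free:
  obtains \<rho> where "0 < \<rho>" "\<And>s. norm (s - 1) < \<rho> \<Longrightarrow> zeta_reg s \<noteq> 0"
proof -
  have "open {s \<in> {s. 0 < Re s}. zeta_reg s \<noteq> 0}"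
    by (rule open_nonzero[OF zeta_reg_series(1) open_halfplane])
  moreover have "1 \<in> {s \<in> {s. 0 < Re s}. zeta_reg s \<noteq> 0}" by (simp add: zeta_reg_1)
  ultimately obtain e where e: "0 < e" "ball 1 e \<subseteq> {s \<in> {s. 0 < Re s}. zeta_reg s \<noteq> 0}"
    by (meson open_contains_ball)
  show ?thesis
  proof (rule that[of e])
    show "zeta_reg s \<noteq> 0" if "norm (s - 1) < e" for s
      using e(2) that by (auto simp: dist_norm norm_minus_commute subset_iff)
  qed (use e in auto)
qed

text \<open>
  Here \<open>C\<close> is chosen so that \<open>ln (16 M / \<eta>) \<le> C ln Q\<close>: the product \<open>M\<close> of the four bounds on the disk
  \<open>|s - 1| \<le> 3/4\<close> is \<open>O(Q^4)\<close>, and \<open>1/\<eta> = y\<^sup>2\<close> costs at most another \<open>2 ln Q\<close>.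
\<close>
lemma real_primitive_chars_zero_unique:
  fixes Q y r C :: real
  defines "W \<equiv> (\<Sum>n. 1 / real (Suc n) powr (5/4))"
  assumes k: "1 \<le> k" and Q: "1 \<le> Q" "1 \<le> ln Q" and y: "ln Q = y ^ (4 * k)"
    and C: "C = \<bar>ln (16 * ((1 + 9 * W) * (9 * W) ^ 3))\<bar> + 6"
    and ybig: "8 * real (Suc (4 * k)) * C * 8 ^ Suc (4 * k) + 1 / \<rho> \<le> y"
    and rho: "0 < \<rho>" "\<And>s. norm (s - 1) < \<rho> \<Longrightarrow> zeta_reg s \<noteq> 0"
    and H: "\<And>q chi s. (q, chi) \<in> real_primitive_chars (Q ^ 2) \<Longrightarrow> 1 < q \<Longrightarrow>
        dirichlet_L q chi s = 0 \<Longrightarrow> norm (s - 1) < 1 / (2 * y) \<Longrightarrow> s \<in> \<real>"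
    and c1: "(q1, chi1) \<in> real_primitive_chars Q" and c2: "(q2, chi2) \<in> real_primitive_chars Q"
    and z1: "dirichlet_L q1 chi1 (of_real beta1) = 0" "1 - 1 / y ^ 4 \<le> beta1" "beta1 < 1"
    and z2: "dirichlet_L q2 chi2 (of_real beta2) = 0" "1 - 1 / y ^ 4 \<le> beta2" "beta2 < 1"
  shows "(q1, chi1) = (q2, chi2)"
proof (rule ccontr)
  assume ne: "(q1, chi1) \<noteq> (q2, chi2)"
  have C1: "6 \<le> C" by (simp add: C)
  have "1 \<le> (8::real) ^ Suc (4 * k)" by (rule one_le_power) simp
  then have "8 * 1 * 1 * 1 \<le> 8 * real (Suc (4 * k)) * C * 8 ^ Suc (4 * k)"
    using C1 by (intro mult_mono) simp_all
  moreover have irho: "0 < 1 / \<rho>" using rho by simp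
  ultimately have y8: "8 \<le> y" and yrho: "1 / \<rho> < y" and yC: "8 * real (Suc (4 * k)) * C * 8 ^ Suc (4 * k) \<le> y"
    using ybig by linarith+
  have yr: "1 / y < \<rho>" using yrho rho y8 by (simp add: field_simps)
  have y2: "8 \<le> y ^ 2" using mult_mono[of 8 y 1 y] y8 by (simp add: power2_eq_square)
  have y4: "y ^ 2 \<le> y ^ 4" using y8 by (intro power_increasing) auto
  have y1: "y \<le> y ^ 4" using power_increasing[of 1 4 y] y8 by simp
  have d8: "1 / y ^ 4 \<le> 1 / 8" using y2 y4 by (intro divide_left_mono) auto
  have e8: "1 / y ^ 2 \<le> 1 / 8" using y2 by (intro divide_left_mono) auto
  have drho: "1 / y ^ 4 < \<rho>"
    by (rule le_less_trans[OF _ yr]) (use y1 y8 in \<open>intro divide_left_mono, auto\<close>)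
  have p: "primitive_char q1 chi1" "primitive_char q2 chi2" and real: "\<And>n. chi1 n \<in> \<real>" "\<And>n. chi2 n \<in> \<real>"
    and le: "real q1 \<le> Q" "real q2 \<le> Q"
    using c1 c2 by (auto simp: real_primitive_chars_def)
  have d: "dirichlet_char q1 chi1" "dirichlet_char q2 chi2" using p by (simp_all add: primitive_char_def)
  \<comment> \<open>The trivial character is excluded because the zeta function has no zero near 1.\<close>
  have nonprincipal: "\<not> principal_char q chi"
    if "primitive_char q chi" "dirichlet_L q chi (of_real b) = 0" "1 - 1 / y ^ 4 \<le> b" "b < 1" for q chi b
  proof
    assume "principal_char q chi"
    then have q: "q = 1" using primitive_principal_modulus that(1) by blast
    then have "chi = (\<lambda>_. 1)" using that(1) by (intro dirichlet_char_modulus_1) (simp add: primitive_char_def)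
    then have "zeta_reg (of_real b) / (of_real b - 1) = 0"
      using that q dirichlet_L_trivial[of "of_real b"] d8 by auto
    then have "zeta_reg (of_real b) = 0" using that(4) by auto
    moreover have "norm (complex_of_real b - 1) < \<rho>"
    proof -
      have "norm (complex_of_real b - 1) = \<bar>b - 1\<bar>" by (metis norm_of_real of_real_1 of_real_diff)
      then show ?thesis using that drho by simp
    qed
    ultimately show False using rho(2) by blast
  qed
  have np: "\<not> principal_char q1 chi1" "\<not> principal_char q2 chi2"
    using nonprincipal[OF p(1) z1] nonprincipal[OF p(2) z2] by blast+
  let ?chi = "\<lambda>n. chi1 n * chi2 n"
  have d3: "dirichlet_char (q1 * q2) ?chi" by (rule dirichlet_char_mult[OF d])
  have np3: "\<not> principal_char (q1 * q2) ?chi" by (rule product_nonprincipal[OF p real ne])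
  obtain q3 psi where psi: "induced_by (q1 * q2) ?chi q3 psi" "primitive_char q3 psi"
    using induced_by_primitive[OF d3] .
  have q0: "0 < q1" "0 < q2" using d by (simp_all add: dirichlet_char_def)
  have psi_np: "\<not> principal_char q3 psi"
  proof
    assume "principal_char q3 psi"
    moreover then have "q3 = 1" by (rule primitive_principal_modulus[OF psi(2)])
    ultimately have "principal_char (q1 * q2) ?chi"
      using psi(1) d3 by (simp add: principal_char_def induced_by_def)
    then show False using np3 by simp
  qed
  have dpsi: "dirichlet_char q3 psi" using psi(2) by (simp add: primitive_char_def)
  have psi_real: "psi n \<in> \<real>" for n
    by (rule induced_by_real[OF psi(1)]) (use q0 real in auto)
  have QQ: "Q \<le> Q ^ 2" using Q(1) by (simp add: power2_eq_square)
  have q12: "real (q1 * q2) \<le> Q ^ 2"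
    using le Q unfolding power2_eq_square of_nat_mult by (intro mult_mono) auto
  have "q3 \<le> q1 * q2" using psi(1) q0 by (intro dvd_imp_le) (auto simp: induced_by_def)
  then have "real q3 \<le> Q ^ 2" using q12 by linarith
  then have mem: "(q1, chi1) \<in> real_primitive_chars (Q ^ 2)" "(q2, chi2) \<in> real_primitive_chars (Q ^ 2)"
    "(q3, psi) \<in> real_primitive_chars (Q ^ 2)"
    using p psi(2) real psi_real q0 dpsi le QQ by (auto simp: real_primitive_chars_def dirichlet_char_def)
  have big: "1 < q" if "dirichlet_char q chi" "\<not> principal_char q chi" for q chi
  proof (rule ccontr)
    assume "\<not> 1 < q"
    then have "q = 1" using that(1) by (auto simp: dirichlet_char_def)
    then show False using that dirichlet_char_modulus_1[of chi] by (auto simp: principal_char_def)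
  qed
  \<comment> \<open>The hypothesis on zeros, transferred to the Dirichlet series.\<close>
  have zero_real: "s \<in> \<real>"
    if "(q, chi) \<in> real_primitive_chars (Q ^ 2)" "dirichlet_char q chi" "\<not> principal_char q chi"
      "dseries chi s = 0" "norm (s - 1) < 1 / (2 * y)" "0 < Re s" for q chi s
    using H[OF that(1) big[OF that(2,3)], of s] dirichlet_L_nonprincipal[OF that(2,3,6)] that(4,5) by simp
  have W0: "0 \<le> W" unfolding W_def by (rule suminf_nonneg[OF summable_Suc_powr]) auto
  have bnd: "norm (dseries chi s) \<le> 9 * real q * W"
    if "dirichlet_char q chi" "\<not> principal_char q chi" "s \<in> cball 1 (3/4)" for q chi s
    unfolding W_def
    by (rule dseries_bounded_partial_sums(2)[OF dirichlet_char_partial_sums[OF that(1,2)] that(3)])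
  define M where "M = (1 + 9 * W) * (9 * real q1 * W) * (9 * real q2 * W) * (9 * real (q1 * q2) * W)"
  have "2 / (1 / y ^ 2 + 1 / y ^ 4) ^ Suc (4 * k)
      \<le> 1 / (1 / y ^ 2) ^ Suc (4 * k) + 2 * real (Suc (4 * k)) * (2 / (1 / (4 * y))) ^ Suc (4 * k) * ln (16 * M / (1 / y ^ 2))"
    unfolding M_def
  proof (rule two_zeros_inequality[OF dirichlet_char_cmult_bounded[OF d(1)] dirichlet_char_cmult_bounded[OF d(2)] real])
    show "dseries chi1 holomorphic_on {s. 0 < Re s}" "dseries chi2 holomorphic_on {s. 0 < Re s}"
      "dseries ?chi holomorphic_on {s. 0 < Re s}"
      by (rule dseries_bounded_partial_sums(1), rule dirichlet_char_partial_sums, fact+)+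
    show "norm (zeta_reg s) \<le> 1 + 9 * W" if "s \<in> cball 1 (3/4)" for s
      unfolding W_def by (rule zeta_reg_series(3)[OF that])
    show "norm (dseries chi1 s) \<le> 9 * real q1 * W" if "s \<in> cball 1 (3/4)" for s by (rule bnd[OF d(1) np(1) that])
    show "norm (dseries chi2 s) \<le> 9 * real q2 * W" if "s \<in> cball 1 (3/4)" for s by (rule bnd[OF d(2) np(2) that])
    show "norm (dseries ?chi s) \<le> 9 * real (q1 * q2) * W" if "s \<in> cball 1 (3/4)" for s by (rule bnd[OF d3 np3 that])
    have b0: "0 < beta1" "0 < beta2" using z1 z2 d8 by auto
    show "dseries chi1 (of_real beta1) = 0"
      using dirichlet_L_nonprincipal[OF d(1) np(1), of "of_real beta1"] z1(1) b0 by simp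
    show "dseries chi2 (of_real beta2) = 0"
      using dirichlet_L_nonprincipal[OF d(2) np(2), of "of_real beta2"] z2(1) b0 by simp
    show "1 / (4 * y) \<le> 1 / 6" using y8 by (intro divide_left_mono) auto
    show "0 < 1 / (4 * y)" "0 < 1 / y ^ 2" using y8 by auto
    show "s \<in> \<real>" if s: "s \<in> ball (1 + of_real (1 / y ^ 2)) (1 / (4 * y))"
      and z: "zeta_reg s = 0 \<or> dseries chi1 s = 0 \<or> dseries chi2 s = 0 \<or> dseries ?chi s = 0" for s
    proof -
      have "norm (s - 1) \<le> norm (s - (1 + of_real (1 / y ^ 2))) + norm (complex_of_real (1 / y ^ 2))"
        using norm_triangle_ineq[of "s - (1 + of_real (1 / y ^ 2))" "of_real (1 / y ^ 2)"] by simp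
      moreover have "norm (s - (1 + of_real (1 / y ^ 2))) < 1 / (4 * y)"
        using s by (simp only: mem_ball dist_norm norm_minus_commute)
      moreover have "norm (complex_of_real (1 / y ^ 2)) \<le> 1 / (4 * y)"
      proof -
        have "4 * y \<le> y ^ 2" unfolding power2_eq_square using y8 by (intro mult_right_mono) auto
        then have "1 / y ^ 2 \<le> 1 / (4 * y)" using y8 by (intro divide_left_mono) auto
        moreover have "norm (complex_of_real (1 / y ^ 2)) = 1 / y ^ 2" unfolding norm_of_real by simp
        ultimately show ?thesis by simp
      qed
      moreover have "1 / (4 * y) + 1 / (4 * y) = 1 / (2 * y)" by simp
      ultimately have n: "norm (s - 1) < 1 / (2 * y)" by linarith
      have half: "1 / (2 * y) \<le> 1 / y" "1 / (2 * y) \<le> 1 / 2" using y8 by (auto simp: field_simps)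
      have "\<bar>Re s - 1\<bar> \<le> norm (s - 1)" using abs_Re_le_cmod[of "s - 1"] by simp
      then have Re: "0 < Re s" using n half(2) by linarith
      have "zeta_reg s \<noteq> 0" by (rule rho(2)) (use n half(1) yr in linarith)
      then consider "dseries chi1 s = 0" | "dseries chi2 s = 0" | "dseries ?chi s = 0" using z by blast
      then show ?thesis
      proof cases
        case 1 then show ?thesis by (rule zero_real[OF mem(1) d(1) np(1) _ n Re])
      next
        case 2 then show ?thesis by (rule zero_real[OF mem(2) d(2) np(2) _ n Re])
      next
        case 3
        then have "dseries psi s = 0" by (rule induced_zero[OF psi(1) d3 np3 psi_np Re])
        then show ?thesis by (rule zero_real[OF mem(3) dpsi psi_np _ n Re])
      qed
    qed
  qed (fact z1 z2 d8 e8)+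
  moreover have "ln (16 * M / (1 / y ^ 2)) \<le> C * y ^ (4 * k)"
  \<comment> \<open>In fact \<open>W > 0\<close>; in the degenerate case the convention \<open>ln 0 = 0\<close> settles the claim.\<close>
  proof (cases "W = 0")
    case True
    then show ?thesis using C1 y8 by (simp add: M_def)
  next
    case False
    define c0 where "c0 = 16 * ((1 + 9 * W) * (9 * W) ^ 3)"
    have c0: "0 < c0" using W0 False by (auto simp: c0_def intro!: mult_pos_pos)
    have Qpos: "0 < Q" using Q by simp
    have Meq: "16 * M = c0 * (real q1 * real q2 * real (q1 * q2))"
      by (simp add: M_def c0_def power3_eq_cube)
    have "real q1 * real q2 * real (q1 * q2) \<le> Q ^ 4"
    proof -
      have "real q1 * real q2 \<le> Q ^ 2" using q12 by simp
      then have "real q1 * real q2 * real (q1 * q2) \<le> Q ^ 2 * Q ^ 2" using q12 by (intro mult_mono) auto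
      then show ?thesis by (simp flip: power_add)
    qed
    then have "16 * M * y ^ 2 \<le> c0 * Q ^ 4 * y ^ 2"
      unfolding Meq using c0 by (intro mult_right_mono mult_left_mono) auto
    moreover have "0 < 16 * M * y ^ 2" unfolding Meq using c0 q0 y8 by simp
    ultimately have "ln (16 * M * y ^ 2) \<le> ln (c0 * Q ^ 4 * y ^ 2)" by (subst ln_le_cancel_iff) auto
    also have "\<dots> = ln c0 + 4 * ln Q + 2 * ln y"
      using c0 Qpos y8 by (simp add: ln_mult ln_realpow)
    also have "\<dots> \<le> (C - 6) * ln Q + 4 * ln Q + 2 * ln Q"
    proof -
      have "ln c0 \<le> \<bar>ln c0\<bar> * 1" by simp
      also have "\<dots> \<le> \<bar>ln c0\<bar> * ln Q" using Q by (intro mult_left_mono) auto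
      also have "\<bar>ln c0\<bar> = C - 6" by (simp add: C c0_def)
      finally have "ln c0 \<le> (C - 6) * ln Q" .
      moreover have "ln y \<le> y" using ln_le_minus_one[of y] y8 by simp
      moreover have "y \<le> ln Q" unfolding y using power_increasing[of 1 "4 * k" y] k y8 by simp
      ultimately show ?thesis by linarith
    qed
    also have "\<dots> = C * y ^ (4 * k)" unfolding y by (simp add: algebra_simps)
    finally show ?thesis by simp
  qed
  note two_zeros_inequality_fails[OF _ yC this]
  moreover have "1 \<le> C" using C1 by simp
  ultimately show False by linarith
qed

section \<open>The theorem\<close>

theorem theorem1p2:
  "\<exists>p :: program. \<forall>(\<nu> :: real \<Rightarrow> real) (\<epsilon> :: real) A k.
     (\<forall>x. 0 < \<nu> x) \<longrightarrow>
     (\<nu> \<longlongrightarrow> 0) at_top \<longrightarrow>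
     mono_on {1<..} (\<lambda>x. ln x powr \<nu> x) \<longrightarrow>
     filterlim (\<lambda>x. ln x powr \<nu> x) at_top at_top \<longrightarrow>
     0 < \<epsilon> \<longrightarrow>
     effective_data \<nu> \<epsilon> A k \<longrightarrow>
     (\<exists>Q\<^sub>0 :: nat. computes A p [k] Q\<^sub>0 \<and> 1 \<le> Q\<^sub>0 \<and>
        (\<forall>Q :: real. real Q\<^sub>0 \<le> Q \<longrightarrow>
           (\<forall>(q, chi) \<in> real_primitive_chars (Q ^ 2). hypothesis_H (\<lambda>x. ln x powr \<nu> x) q chi) \<longrightarrow>
           (let Z = {(q, chi) \<in> real_primitive_chars Q.
                       has_real_zero_in q chi {1 - ln Q powr (- \<epsilon>)..<1}}
            in finite Z \<and> card Z \<le> 1)))"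
proof -
  define W where "W = (\<Sum>n. 1 / real (Suc n) powr (5/4))"
  define C where "C = \<bar>ln (16 * ((1 + 9 * W) * (9 * W) ^ 3))\<bar> + 6"
  obtain \<rho> where rho: "0 < \<rho>" "\<And>s. norm (s - 1) < \<rho> \<Longrightarrow> zeta_reg s \<noteq> 0"
    using zeta_reg_zero_free by blast
  have "0 \<le> C" "0 \<le> 1 / \<rho>" using rho by (auto simp: C_def)
  then obtain m where m: "\<And>k Q. 1 \<le> k \<Longrightarrow> 2 ^ 2 ^ (m * (k * k)) \<le> Q \<Longrightarrow>
      8 * real (Suc (4 * k)) * C * 8 ^ Suc (4 * k) + 1 / \<rho> \<le> ln Q powr (1 / real (4 * k)) \<and> 1 \<le> ln Q \<and> 1 \<le> Q"
    using threshold_large by blast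
  obtain p where p: "\<And>A k. computes A p [k] (A 0 (4 * k) + 2 ^ 2 ^ (m * (k * k)))"
    using threshold_computable[of m] by blast
  show ?thesis
  proof (intro exI[of _ p] allI impI)
    fix \<nu> :: "real \<Rightarrow> real" and \<epsilon> :: real and A k
    assume mono: "mono_on {1<..} (\<lambda>x. ln x powr \<nu> x)" and data: "effective_data \<nu> \<epsilon> A k"
    have k: "1 \<le> k" and eps: "1 / real k \<le> \<epsilon>"
      and rate: "\<And>n x. real (A 0 n) \<le> x \<Longrightarrow> \<nu> x \<le> 1 / real (Suc n)"
      using data by (auto simp: effective_data_def)
    let ?Q0 = "A 0 (4 * k) + 2 ^ 2 ^ (m * (k * k))"
    show "\<exists>Q\<^sub>0 :: nat. computes A p [k] Q\<^sub>0 \<and> 1 \<le> Q\<^sub>0 \<and>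
        (\<forall>Q :: real. real Q\<^sub>0 \<le> Q \<longrightarrow>
           (\<forall>(q, chi) \<in> real_primitive_chars (Q ^ 2). hypothesis_H (\<lambda>x. ln x powr \<nu> x) q chi) \<longrightarrow>
           (let Z = {(q, chi) \<in> real_primitive_chars Q.
                       has_real_zero_in q chi {1 - ln Q powr (- \<epsilon>)..<1}}
            in finite Z \<and> card Z \<le> 1))"
    proof (intro exI[of _ ?Q0] conjI allI impI p)
      show "1 \<le> ?Q0" by (simp add: trans_le_add2)
      fix Q :: real
      assume Q: "real ?Q0 \<le> Q"
        and hyp: "\<forall>(q, chi) \<in> real_primitive_chars (Q ^ 2). hypothesis_H (\<lambda>x. ln x powr \<nu> x) q chi"
      have QA: "real (A 0 (4 * k)) \<le> Q" and Qt: "2 ^ 2 ^ (m * (k * k)) \<le> Q"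
        using Q by (simp_all add: add_increasing2 add_increasing order_trans[rotated])
      define y where "y = ln Q powr (1 / real (4 * k))"
      have big: "8 * real (Suc (4 * k)) * C * 8 ^ Suc (4 * k) + 1 / \<rho> \<le> y" and Q1: "1 \<le> ln Q" "1 \<le> Q"
        using m[OF k Qt] by (auto simp: y_def)
      have y1: "1 \<le> y" unfolding y_def using Q1 by (intro ge_one_powr_ge_zero) auto
      have "y ^ (4 * k) = y powr real (4 * k)" by (rule powr_realpow[symmetric]) (use y1 in simp)
      also have "\<dots> = ln Q" using Q1 k by (simp add: y_def powr_powr)
      finally have ypow: "ln Q = y ^ (4 * k)" ..
      have H: "s \<in> \<real>"
        if c: "(q, chi) \<in> real_primitive_chars (Q ^ 2)" "1 < q" and s: "dirichlet_L q chi s = 0" "norm (s - 1) < 1 / (2 * y)"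
        for q chi s
      proof -
        have qQ: "real q \<le> Q ^ 2" "1 < real q" using c by (auto simp: real_primitive_chars_def)
        \<comment> \<open>The disk on which the zeros are known to be real is smallest at the largest conductor \<open>Q\<^sup>2\<close>;
          there \<open>\<nu>\<close> is below \<open>1/(4k)\<close>, so that \<open>f(q) \<le> (2 ln Q) powr (1/(4k)) \<le> 2y\<close>.\<close>
        have "ln (real q) powr \<nu> (real q) \<le> ln (Q ^ 2) powr \<nu> (Q ^ 2)"
          using mono_onD[OF mono, of "real q" "Q ^ 2"] qQ by auto
        also have "ln (Q ^ 2) = 2 * ln Q" using Q1 by (simp add: ln_realpow)
        also have "(2 * ln Q) powr \<nu> (Q ^ 2) \<le> (2 * ln Q) powr (1 / real (4 * k))"
        proof (rule powr_mono)
          have "Q \<le> Q ^ 2" using Q1 by (simp add: power2_eq_square)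
          then have "\<nu> (Q ^ 2) \<le> 1 / real (Suc (4 * k))" using QA by (intro rate) simp
          also have "\<dots> \<le> 1 / real (4 * k)" using k by (intro divide_left_mono) auto
          finally show "\<nu> (Q ^ 2) \<le> 1 / real (4 * k)" .
        qed (use Q1 in simp)
        also have "\<dots> = 2 powr (1 / real (4 * k)) * y"
          using Q1 by (simp add: powr_mult y_def)
        also have "\<dots> \<le> 2 * y"
          using powr_mono[of "1 / real (4 * k)" 1 2] y1 k by (intro mult_right_mono) auto
        finally have le: "ln (real q) powr \<nu> (real q) \<le> 2 * y" .
        have "0 < ln (real q) powr \<nu> (real q)" using qQ by (simp add: ln_gt_zero)
        then have "1 / (2 * y) \<le> 1 / (ln (real q) powr \<nu> (real q))" using le by (intro divide_left_mono) (use y1 in auto)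
        then have "norm (s - 1) < 1 / (ln (real q) powr \<nu> (real q))" using s(2) by simp
        then show ?thesis using hyp c s(1) by (auto simp: hypothesis_H_def)
      qed
      define Z where "Z = {(q, chi) \<in> real_primitive_chars Q. has_real_zero_in q chi {1 - ln Q powr (- \<epsilon>)..<1}}"
      have delta: "ln Q powr (- \<epsilon>) \<le> 1 / y ^ 4"
      proof -
        have "ln Q powr (- \<epsilon>) \<le> ln Q powr (- (1 / real k))" using Q1 eps by (intro powr_mono) auto
        also have "ln Q powr (1 / real k) = y ^ 4"
          unfolding y_def using Q1 k by (simp add: powr_powr flip: powr_numeral)
        then have "ln Q powr (- (1 / real k)) = 1 / y ^ 4" by (simp add: powr_minus_divide)
        finally show ?thesis .
      qed
      have uniq: "a = b" if "a \<in> Z" "b \<in> Z" for a b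
      proof -
        obtain q1 chi1 beta1 where a: "a = (q1, chi1)" "(q1, chi1) \<in> real_primitive_chars Q"
          "dirichlet_L q1 chi1 (of_real beta1) = 0" "1 - ln Q powr (- \<epsilon>) \<le> beta1" "beta1 < 1"
          using \<open>a \<in> Z\<close> by (auto simp: Z_def has_real_zero_in_def)
        obtain q2 chi2 beta2 where b: "b = (q2, chi2)" "(q2, chi2) \<in> real_primitive_chars Q"
          "dirichlet_L q2 chi2 (of_real beta2) = 0" "1 - ln Q powr (- \<epsilon>) \<le> beta2" "beta2 < 1"
          using \<open>b \<in> Z\<close> by (auto simp: Z_def has_real_zero_in_def)
        have le: "1 - 1 / y ^ 4 \<le> beta1" "1 - 1 / y ^ 4 \<le> beta2" using delta a(4) b(4) by linarith+
        show ?thesis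
          unfolding a(1) b(1)
          by (rule real_primitive_chars_zero_unique[OF k Q1(2,1) ypow C_def[unfolded W_def] big rho H
                a(2) b(2) a(3) le(1) a(5) b(3) le(2) b(5)])
      qed
      have "\<exists>a. Z \<subseteq> {a}"
      proof (cases "Z = {}")
        case False
        then obtain a where "a \<in> Z" by blast
        then have "Z \<subseteq> {a}" using uniq[OF _ \<open>a \<in> Z\<close>] by blast
        then show ?thesis by blast
      qed simp
      then obtain a where "Z \<subseteq> {a}" by blast
      then have "finite Z \<and> card Z \<le> 1"
        using finite_subset[of Z "{a}"] card_mono[of "{a}" Z] by simp
      then show "let Z = {(q, chi) \<in> real_primitive_chars Q. has_real_zero_in q chi {1 - ln Q powr (- \<epsilon>)..<1}}
            in finite Z \<and> card Z \<le> 1"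
        unfolding Z_def Let_def .
    qed
  qed
qed

end
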